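(* Let $X,Y$ be complex Banach spaces and assume that $X$ is reflexive and has a finite cotype. Let $T\colon X\to X$ be an $R$-Ritt operator satisfying an $R$-square function estimate, i.e. there exists a constant $\kappa\geq 0$ such that for every $x\in X$ the series below converges in $\mathrm{Rad}(X)$ and $$\Bigl\Vert\sum_{k=1}^{\infty}k^{\frac12}\,\varepsilon_k\otimes\bigl(T^k(x)-T^{k-1}(x)\bigr)\Bigr\Vert_{\mathrm{Rad}(X)}\leq\kappa\Vert x\Vert,\qquad x\in X.$$ Let $\alpha>-1$ and $\beta\in(-1,3)$ be real numbers such that $m=\frac{\alpha+\beta}{2}$ is a nonnegative integer. Then a bounded operator $C\colon X\to Y$ is $\alpha$-$R$-admissible for $T$ if the set $$\Bigl\{\bigl(1-\vert\omega\vert^2\bigr)^{\frac{1+\beta}{2}}C(I-\omega T)^{-(m+1)}\, :\,\omega\in\mathbb{D}\Bigr\}\subset B(X,Y)$$ is $R$-bounded.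
   Context: $\mathbb{D}=\{\omega\in\mathbb{C}: |\omega|<1\}$; $B(X,Y)$ is the Banach space of bounded operators from $X$ to $Y$. Let $(\varepsilon_k)_{k\geq1}$ be a sequence of independent Rademacher variables on a probability space $(\mathcal{M},d\mathbb{P})$. For a Banach space $X$, $\mathrm{Rad}(X)$ is the closed subspace of the Bochner space $L^2(\mathcal{M};X)$ spanned by $\{\varepsilon_k\otimes x: k\geq1,\ x\in X\}$, so that for finite families $\bigl\Vert\sum_k\varepsilon_k\otimes x_k\bigr\Vert_{\mathrm{Rad}(X)}=\bigl(\int_{\mathcal{M}}\Vert\sum_k\varepsilon_k(u)x_k\Vert_X^2\,d\mathbb{P}(u)\bigr)^{1/2}$. A subset $F\subset B(X,Y)$ is $R$-bounded if there is $K\geq0$ such that $\bigl\Vert\sum_k\varepsilon_k\otimes V_k(x_k)\bigr\Vert_{\mathrm{Rad}(Y)}\leq K\bigl\Vert\sum_k\varepsilon_k\otimes x_k\bigr\Vert_{\mathrm{Rad}(X)}$ for all finite families $(V_k)_k$ in $F$ and $(x_k)_k$ in $X$. A bounded operator $T\colon X\to X$ is an $R$-Ritt operator if the two sets $\{T^k: k\geq0\}$ and $\{k(T^k-T^{k-1}): k\geq1\}$ are both $R$-bounded. For a power bounded $T\colon X\to X$ (i.e. $\sup_{k\ge 0}\Vert T^k\Vert<\infty$) and real $\alpha>-1$, a bounded operator $C\colon X\to Y$ is $\alpha$-$R$-admissible for $T$ if for every $x\in X$ the series $\sum_{k\geq1}k^{\frac{\alpha}{2}}\varepsilon_k\otimes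 CT^{k-1}(x)$ converges in $\mathrm{Rad}(Y)$ and there is a constant $M\geq0$ such that $\bigl\Vert\sum_{k=1}^{\infty}k^{\frac{\alpha}{2}}\varepsilon_k\otimes CT^{k-1}(x)\bigr\Vert_{\mathrm{Rad}(Y)}\leq M\Vert x\Vert$ for all $x\in X$. *)

theory Defs
  imports "HOL-Probability.Probability"
begin

section \<open>Complex Banach spaces\<close>

class complex_normed_vector = real_normed_vector +
  fixes scaleC :: "complex \<Rightarrow> 'a \<Rightarrow> 'a"  (infixr "*\<^sub>C" 75)
  assumes scaleC_add_right: "c *\<^sub>C (x + y) = c *\<^sub>C x + c *\<^sub>C y"
    and scaleC_add_left: "(c + d) *\<^sub>C x = c *\<^sub>C x + d *\<^sub>C x"
    and scaleC_scaleC: "c *\<^sub>C d *\<^sub>C x = (c * d) *\<^sub>C x"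
    and scaleR_eq_scaleC: "r *\<^sub>R x = complex_of_real r *\<^sub>C x"
    and norm_scaleC: "norm (c *\<^sub>C x) = cmod c * norm x"

class complex_banach = complex_normed_vector + banach

instantiation complex :: complex_banach
begin

definition scaleC_complex :: "complex \<Rightarrow> complex \<Rightarrow> complex"
  where "scaleC_complex c z = c * z"

instance
  by standard (simp_all add: scaleC_complex_def algebra_simps norm_mult scaleR_conv_of_real)

end

text \<open>Elements of \<open>B(X,Y)\<close> are functions satisfying the following predicate.\<close>

definition bounded_clinear :: "('a::complex_normed_vector \<Rightarrow> 'b::complex_normed_vector) \<Rightarrow> bool"
  where "bounded_clinear f \<longleftrightarrow> bounded_linear f \<and> (\<forall>c x. f (c *\<^sub>C x) = c *\<^sub>C f x)"

text \<open>Reflexivity: every bounded complex-linear functional \<open>\<phi>\<close> on the dual is evaluation at a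
  point. The dual is the set of bounded complex-linear \<open>f\<close>, normed by \<open>onorm\<close>; the values of
  \<open>\<phi>\<close> outside this set play no role.\<close>

definition reflexive_space :: "'a::complex_banach itself \<Rightarrow> bool"
  where "reflexive_space X \<longleftrightarrow>
    (\<forall>\<phi> :: ('a \<Rightarrow> complex) \<Rightarrow> complex.
       (\<forall>f g. bounded_clinear f \<longrightarrow> bounded_clinear g \<longrightarrow> \<phi> (\<lambda>x. f x + g x) = \<phi> f + \<phi> g) \<longrightarrow>
       (\<forall>c f. bounded_clinear f \<longrightarrow> \<phi> (\<lambda>x. c * f x) = c * \<phi> f) \<longrightarrow>
       (\<exists>K. \<forall>f. bounded_clinear f \<longrightarrow> cmod (\<phi> f) \<le> K * onorm f) \<longrightarrow>
       (\<exists>x. \<forall>f. bounded_clinear f \<longrightarrow> \<phi> f = f x))"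


section \<open>Rademacher sums\<close>

definition rademacher_sequence :: "'m measure \<Rightarrow> (nat \<Rightarrow> 'm \<Rightarrow> real) \<Rightarrow> bool"
  where "rademacher_sequence P \<epsilon> \<longleftrightarrow>
    prob_space P \<and>
    prob_space.indep_vars P (\<lambda>_. borel) \<epsilon> {1..} \<and>
    (\<forall>k\<ge>1. measure P {u \<in> space P. \<epsilon> k u = 1} = 1 / 2 \<and>
            measure P {u \<in> space P. \<epsilon> k u = - 1} = 1 / 2)"

text \<open>The library's \<open>integrable\<close> requires a second countable codomain, which would force \<open>X\<close> to be
  separable. So strong measurability is spelled out: pointwise limit of simple functions.
  Elements of the Bochner space \<open>L\<^sup>2(P;X)\<close> are represented by functions that are not identified
  when they agree almost everywhere.\<close>

definition strongly_measurable :: "'m measure \<Rightarrow> ('m \<Rightarrow> 'a::complex_banach) \<Rightarrow> bool"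
  where "strongly_measurable P f \<longleftrightarrow>
    (\<exists>s. (\<forall>i. simple_function P (s i)) \<and> (\<forall>u\<in>space P. (\<lambda>i. s i u) \<longlonglongrightarrow> f u))"

definition bochner_L2 :: "'m measure \<Rightarrow> ('m \<Rightarrow> 'a::complex_banach) set"
  where "bochner_L2 P = {f. strongly_measurable P f \<and> integrable P (\<lambda>u. (norm (f u))\<^sup>2)}"

definition L2_norm :: "'m measure \<Rightarrow> ('m \<Rightarrow> 'a::complex_banach) \<Rightarrow> real"
  where "L2_norm P f = sqrt (\<integral>u. (norm (f u))\<^sup>2 \<partial>P)"

definition rad_sum :: "(nat \<Rightarrow> 'm \<Rightarrow> real) \<Rightarrow> nat \<Rightarrow> (nat \<Rightarrow> 'a::complex_banach) \<Rightarrow> 'm \<Rightarrow> 'a"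
  where "rad_sum \<epsilon> n x u = (\<Sum>k=1..n. \<epsilon> k u *\<^sub>R x k)"

text \<open>The sums \<open>rad_sum \<epsilon> n x\<close> are exactly the elements of the linear span of
  all \<open>\<epsilon>\<^sub>k \<otimes> x\<close>, so the following set is its closure in \<open>L\<^sup>2(P;X)\<close>.\<close>

definition Rad :: "'m measure \<Rightarrow> (nat \<Rightarrow> 'm \<Rightarrow> real) \<Rightarrow> ('m \<Rightarrow> 'a::complex_banach) set"
  where "Rad P \<epsilon> =
    {f \<in> bochner_L2 P. \<forall>e>0. \<exists>n x. L2_norm P (\<lambda>u. f u - rad_sum \<epsilon> n x u) < e}"

definition rad_sums ::
    "'m measure \<Rightarrow> (nat \<Rightarrow> 'm \<Rightarrow> real) \<Rightarrow> (nat \<Rightarrow> 'a::complex_banach) \<Rightarrow> ('m \<Rightarrow> 'a) \<Rightarrow> bool"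
  where "rad_sums P \<epsilon> x f \<longleftrightarrow>
    f \<in> Rad P \<epsilon> \<and> (\<lambda>n. L2_norm P (\<lambda>u. rad_sum \<epsilon> n x u - f u)) \<longlonglongrightarrow> 0"

definition finite_cotype ::
    "'m measure \<Rightarrow> (nat \<Rightarrow> 'm \<Rightarrow> real) \<Rightarrow> 'a::complex_banach itself \<Rightarrow> bool"
  where "finite_cotype P \<epsilon> X \<longleftrightarrow>
    (\<exists>q\<ge>2. \<exists>K\<ge>0. \<forall>n (x :: nat \<Rightarrow> 'a).
       (\<Sum>k=1..n. norm (x k) powr q) powr (1 / q) \<le> K * L2_norm P (rad_sum \<epsilon> n x))"


section \<open>R-boundedness, R-Ritt operators and R-admissibility\<close>

definition R_bounded ::
    "'m measure \<Rightarrow> (nat \<Rightarrow> 'm \<Rightarrow> real) \<Rightarrow> ('a::complex_banach \<Rightarrow> 'b::complex_banach) set \<Rightarrow> bool"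
  where "R_bounded P \<epsilon> F \<longleftrightarrow>
    (\<forall>V\<in>F. bounded_clinear V) \<and>
    (\<exists>K\<ge>0. \<forall>n V x. (\<forall>k\<in>{1..n}. V k \<in> F) \<longrightarrow>
       L2_norm P (rad_sum \<epsilon> n (\<lambda>k. V k (x k))) \<le> K * L2_norm P (rad_sum \<epsilon> n x))"

definition R_Ritt ::
    "'m measure \<Rightarrow> (nat \<Rightarrow> 'm \<Rightarrow> real) \<Rightarrow> ('a::complex_banach \<Rightarrow> 'a) \<Rightarrow> bool"
  where "R_Ritt P \<epsilon> T \<longleftrightarrow>
    bounded_clinear T \<and>
    R_bounded P \<epsilon> {T ^^ k |k. k \<ge> 0} \<and>
    R_bounded P \<epsilon> {\<lambda>x. real k *\<^sub>R ((T ^^ k) x - (T ^^ (k - 1)) x) |k. k \<ge> 1}"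

text \<open>In the next two definitions the sum \<open>f\<close> is unique up to equality almost everywhere, so
  its norm does not depend on the choice of \<open>f\<close>.\<close>

definition R_square_function_estimate ::
    "'m measure \<Rightarrow> (nat \<Rightarrow> 'm \<Rightarrow> real) \<Rightarrow> ('a::complex_banach \<Rightarrow> 'a) \<Rightarrow> bool"
  where "R_square_function_estimate P \<epsilon> T \<longleftrightarrow>
    (\<exists>\<kappa>\<ge>0. \<forall>x. \<exists>f.
       rad_sums P \<epsilon> (\<lambda>k. real k powr (1 / 2) *\<^sub>R ((T ^^ k) x - (T ^^ (k - 1)) x)) f \<and>
       L2_norm P f \<le> \<kappa> * norm x)"

definition R_admissible ::
    "'m measure \<Rightarrow> (nat \<Rightarrow> 'm \<Rightarrow> real) \<Rightarrow> real \<Rightarrow>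
     ('a::complex_banach \<Rightarrow> 'b::complex_banach) \<Rightarrow> ('a \<Rightarrow> 'a) \<Rightarrow> bool"
  where "R_admissible P \<epsilon> \<alpha> C T \<longleftrightarrow>
    bounded_clinear C \<and>
    (\<exists>K\<ge>0. \<forall>x. \<exists>f.
       rad_sums P \<epsilon> (\<lambda>k. real k powr (\<alpha> / 2) *\<^sub>R C ((T ^^ (k - 1)) x)) f \<and>
       L2_norm P f \<le> K * norm x)"

text \<open>\<open>resolvent_at T \<omega> = (I - \<omega>T)\<^sup>-\<^sup>1\<close>. The function inverse \<open>inv\<close> is meaningful only where
  \<open>I - \<omega>T\<close> is bijective; for a power bounded \<open>T\<close> this covers all \<open>\<omega>\<close> with \<open>\<bar>\<omega>\<bar> < 1\<close>, and
  the inverse is then bounded.\<close>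

definition resolvent_at :: "('a::complex_banach \<Rightarrow> 'a) \<Rightarrow> complex \<Rightarrow> 'a \<Rightarrow> 'a"
  where "resolvent_at T \<omega> = inv (\<lambda>x. x - \<omega> *\<^sub>C T x)"

end

theory Submission imports Defs
begin

text \<open>With \<open>r = 1 - 1/n\<close> write \<open>C T^(n-1)\<close> as \<open>C (I - rT)^-(m+1)\<close> applied after \<open>(I - rT)^(m+1) T^(n-1)\<close>.
  The latter has R-bound of order \<open>n^-(m+1)\<close> because \<open>T\<close> is R-Ritt, so the operators
  \<open>n^((1+\<alpha>)/2) C T^(n-1)\<close> are R-bounded. In particular \<open>C T^n \<rightarrow> 0\<close>, and \<open>C T^(k-1) x\<close> is the sum over
  \<open>i\<close> of \<open>C (T^(a-1) - T^(2a-1)) x\<close> with \<open>a = 2^i k\<close>. Each term is an R-bounded family, up to an explicit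
  power of \<open>a\<close>, applied to \<open>(T^b - T^(b-1)) x\<close> for any \<open>b\<close> comparable to \<open>a\<close> and at most \<open>a/2\<close>. Letting \<open>b\<close>
  run over a block of \<open>2^i\<close> indices attached to \<open>k\<close>, and comparing the single sign of \<open>k\<close> with the sum
  of the \<open>2^i\<close> signs in its block, bounds the \<open>i\<close>-th contribution by \<open>2^(-i(1+\<alpha>)/2)\<close> times a tail of
  the square function of \<open>T\<close>.\<close>

section \<open>Averages over signs\<close>

text \<open>The choice of r gives 1 - r^2 \<ge> 1/n; since m = (\<alpha> + \<beta>)/2, the powers
  n^(m+1) and n^(-(1+\<beta>)/2) then combine to exactly n^((1+\<alpha>)/2). The blocks are what
  makes the dyadic sum converge for every \<alpha> > -1. Pairing k with a single b of size about a
  leaves the coefficient k^(\<alpha>/2) a^((1-\<alpha>)/2) b^(-1/2), of order 2^(-i \<alpha>/2),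
  which does not decay for \<alpha> \<le> 0. Such a pairing uses only about one index in 2^i of the
  square function. Using all of them gains the missing 2^(-i/2), because a sum of 2^i signs has mean
  absolute value of order 2^(i/2). Convergence is part of both hypothesis and conclusion, so the
  estimates concern finite index sets inside tails: indices from 4p on are controlled by the square
  function from p on, and the Cauchy property is inherited. Finite sums depend only on the joint law
  of the signs, so they are studied as uniform averages over subsets; the measure space matters only
  in translating hypotheses and conclusion.\<close>

definition signed_sum :: "'i set \<Rightarrow> 'i set \<Rightarrow> ('i \<Rightarrow> 'a::real_normed_vector) \<Rightarrow> 'a"
  where "signed_sum K S x = (\<Sum>k\<in>K. if k \<in> S then x k else - x k)"

definition avg :: "'i set \<Rightarrow> ('i set \<Rightarrow> real) \<Rightarrow> real"
  where "avg K f = (\<Sum>S\<in>Pow K. f S) / 2 ^ card K"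

text \<open>A subset of \<open>K\<close> records which signs are +1, so this is the norm in Rad of
  the family over \<open>K\<close>, with the measure space removed. Arbitrary finite index sets,
  rather than initial segments, allow for residue classes, tails and blocks of indices.\<close>

definition rad_norm :: "'i set \<Rightarrow> ('i \<Rightarrow> 'a::real_normed_vector) \<Rightarrow> real"
  where "rad_norm K x = sqrt (avg K (\<lambda>S. (norm (signed_sum K S x))\<^sup>2))"

lemma avg_cong: "(\<And>S. S \<subseteq> K \<Longrightarrow> f S = g S) \<Longrightarrow> avg K f = avg K g"
  unfolding avg_def by (auto intro!: sum.cong)

lemma avg_mono: "(\<And>S. S \<subseteq> K \<Longrightarrow> f S \<le> g S) \<Longrightarrow> avg K f \<le> avg K g"
  unfolding avg_def by (auto intro!: divide_right_mono sum_mono)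

lemma avg_nonneg: "(\<And>S. S \<subseteq> K \<Longrightarrow> 0 \<le> f S) \<Longrightarrow> 0 \<le> avg K f"
  unfolding avg_def by (auto intro!: divide_nonneg_nonneg sum_nonneg)

lemma avg_const: "finite K \<Longrightarrow> avg K (\<lambda>_. c) = c"
  unfolding avg_def by (simp add: card_Pow)

lemma avg_add: "avg K (\<lambda>S. f S + g S) = avg K f + avg K g"
  unfolding avg_def by (simp add: sum.distrib add_divide_distrib)

lemma avg_cmult: "avg K (\<lambda>S. c * f S) = c * avg K f"
  unfolding avg_def by (simp add: sum_distrib_left)

lemma avg_swap: "avg K (\<lambda>S. avg J (\<lambda>R. f S R)) = avg J (\<lambda>R. avg K (\<lambda>S. f S R))"
  unfolding avg_def sum_divide_distrib[symmetric]
  by (subst sum.swap) (simp add: divide_divide_eq_left mult.commute)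

lemma avg_insert:
  assumes "finite K" "k \<notin> K"
  shows "avg (insert k K) f = (avg K f + avg K (\<lambda>S. f (insert k S))) / 2"
proof -
  have "(\<Sum>S\<in>Pow (insert k K). f S) = (\<Sum>S\<in>Pow K. f S) + (\<Sum>S\<in>insert k ` Pow K. f S)"
    unfolding Pow_insert using assms by (intro sum.union_disjoint) auto
  also have "(\<Sum>S\<in>insert k ` Pow K. f S) = (\<Sum>S\<in>Pow K. f (insert k S))"
    using assms by (subst sum.reindex) (auto simp: inj_on_def insert_ident)
  finally show ?thesis
    unfolding avg_def using assms by (simp add: add_divide_distrib)
qed

lemma power2_avg_le:
  assumes "finite K"
  shows "(avg K f)\<^sup>2 \<le> avg K (\<lambda>S. (f S)\<^sup>2)"
proof -
  have "0 \<le> avg K (\<lambda>S. (f S - avg K f)\<^sup>2)" by (intro avg_nonneg) simp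
  also have "\<dots> = avg K (\<lambda>S. (f S)\<^sup>2 + ((- 2 * avg K f) * f S + (avg K f)\<^sup>2))"
    by (intro avg_cong) (simp add: power2_eq_square algebra_simps)
  also have "\<dots> = avg K (\<lambda>S. (f S)\<^sup>2) - (avg K f)\<^sup>2"
    by (simp only: avg_add avg_cmult avg_const[OF assms]) (simp add: power2_eq_square)
  finally show ?thesis by simp
qed

lemma signed_sum_cong: "(\<And>k. k \<in> K \<Longrightarrow> x k = y k) \<Longrightarrow> signed_sum K S x = signed_sum K S y"
  unfolding signed_sum_def by (intro sum.cong) auto

lemma signed_sum_insert:
  "finite K \<Longrightarrow> k \<notin> K \<Longrightarrow>
    signed_sum (insert k K) S x = (if k \<in> S then x k else - x k) + signed_sum K S x"
  unfolding signed_sum_def by simp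

lemma signed_sum_insert2: "k \<notin> K \<Longrightarrow> signed_sum K (insert k S) x = signed_sum K S x"
  unfolding signed_sum_def by (intro sum.cong) auto

lemma signed_sum_add: "signed_sum K S (\<lambda>k. x k + y k) = signed_sum K S x + signed_sum K S y"
  unfolding signed_sum_def by (subst sum.distrib[symmetric]) (intro sum.cong, auto)

lemma signed_sum_scaleR: "signed_sum K S (\<lambda>k. c *\<^sub>R x k) = c *\<^sub>R signed_sum K S x"
  unfolding signed_sum_def scaleR_sum_right by (intro sum.cong) auto

lemma rad_norm_cong: "(\<And>k. k \<in> K \<Longrightarrow> x k = y k) \<Longrightarrow> rad_norm K x = rad_norm K y"
  unfolding rad_norm_def using signed_sum_cong[of K x y] by simp

lemma rad_norm_nonneg [simp]: "0 \<le> rad_norm K x"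
  unfolding rad_norm_def by (intro real_sqrt_ge_zero avg_nonneg) simp

lemma rad_norm_squared: "(rad_norm K x)\<^sup>2 = avg K (\<lambda>S. (norm (signed_sum K S x))\<^sup>2)"
  unfolding rad_norm_def by (intro real_sqrt_pow2 avg_nonneg) simp

lemma rad_norm_L2_set:
  "rad_norm K x = L2_set (\<lambda>S. norm (signed_sum K S x)) (Pow K) / sqrt (2 ^ card K)"
  unfolding rad_norm_def avg_def L2_set_def by (simp add: real_sqrt_divide)

lemma rad_norm_add: "rad_norm K (\<lambda>k. x k + y k) \<le> rad_norm K x + rad_norm K y"
proof -
  have "L2_set (\<lambda>S. norm (signed_sum K S (\<lambda>k. x k + y k))) (Pow K) \<le>
      L2_set (\<lambda>S. norm (signed_sum K S x) + norm (signed_sum K S y)) (Pow K)"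
    by (intro L2_set_mono) (auto simp: signed_sum_add norm_triangle_ineq)
  also have "\<dots> \<le> L2_set (\<lambda>S. norm (signed_sum K S x)) (Pow K) + L2_set (\<lambda>S. norm (signed_sum K S y)) (Pow K)"
    by (rule L2_set_triangle_ineq)
  finally show ?thesis
    unfolding rad_norm_L2_set add_divide_distrib[symmetric] by (intro divide_right_mono) auto
qed

lemma rad_norm_scaleR: "rad_norm K (\<lambda>k. c *\<^sub>R x k) = \<bar>c\<bar> * rad_norm K x"
  unfolding rad_norm_def signed_sum_scaleR norm_scaleR power_mult_distrib avg_cmult
  by (simp add: real_sqrt_mult)

lemma rad_norm_zero [simp]: "rad_norm K (\<lambda>k. 0) = 0"
  using rad_norm_scaleR[of K 0] by simp

lemma rad_norm_sum:
  "rad_norm K (\<lambda>k. \<Sum>l\<in>L. f l k) \<le> (\<Sum>l\<in>L. rad_norm K (f l))"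
proof (induction L rule: infinite_finite_induct)
  case (insert l L)
  then show ?case
    using rad_norm_add[of K "f l" "\<lambda>k. \<Sum>l\<in>L. f l k"] by simp
qed auto

text \<open>The map \<open>?d\<close> sends a sign pattern to its symmetric difference with
  \<open>F \<inter> K\<close>. This is an involution of \<open>Pow K\<close>, so the average is
  merely reordered.\<close>

lemma rad_norm_flip:
  "rad_norm K (\<lambda>k. if k \<in> F then - x k else x k) = rad_norm K x"
proof -
  let ?d = "\<lambda>S. (S - F) \<union> (F \<inter> K - S)"
  have "signed_sum K S (\<lambda>k. if k \<in> F then - x k else x k) = signed_sum K (?d S) x" for S
    unfolding signed_sum_def by (intro sum.cong) auto
  then have "avg K (\<lambda>S. (norm (signed_sum K S (\<lambda>k. if k \<in> F then - x k else x k)))\<^sup>2) =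
      avg K (\<lambda>S. (norm (signed_sum K (?d S) x))\<^sup>2)" by simp
  also have "\<dots> = avg K (\<lambda>S. (norm (signed_sum K S x))\<^sup>2)"
    unfolding avg_def
    by (intro arg_cong2[where f="(/)"] refl sum.reindex_bij_witness[of _ ?d ?d]) auto
  finally show ?thesis unfolding rad_norm_def by simp
qed

lemma rad_norm_insert_zero:
  assumes "finite K" "x k = 0"
  shows "rad_norm (insert k K) x = rad_norm K x"
proof (cases "k \<in> K")
  case False
  have "signed_sum (insert k K) S x = signed_sum K S x" for S
    unfolding signed_sum_insert[OF assms(1) False] by (simp add: assms(2))
  then show ?thesis
    using assms False by (simp add: rad_norm_def avg_insert signed_sum_insert2)
qed (simp add: insert_absorb)

lemma rad_norm_zero_ext:
  assumes "finite L" "K \<subseteq> L" "\<And>k. k \<in> L - K \<Longrightarrow> x k = 0"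
  shows "rad_norm L x = rad_norm K x"
proof -
  have "finite K" using assms finite_subset by blast
  have "rad_norm (K \<union> M) x = rad_norm K x" if "finite M" "M \<subseteq> L - K" for M
    using that
  proof (induction M rule: finite_induct)
    case (insert k M)
    then show ?case using assms(3)[of k] rad_norm_insert_zero[of "K \<union> M" x k] \<open>finite K\<close> by simp
  qed simp
  from this[of "L - K"] show ?thesis using assms by (simp add: Un_absorb1)
qed

lemma rad_norm_singleton: "rad_norm {k} x = norm (x k)"
  by (simp add: rad_norm_def avg_insert signed_sum_insert)
     (simp add: avg_def signed_sum_def)

text \<open>A crude bound that ignores cancellation; it serves only for a fixed number of indices or
  for a remainder that tends to 0.\<close>

lemma rad_norm_le_sum:
  assumes "finite K"
  shows "rad_norm K x \<le> (\<Sum>k\<in>K. norm (x k))"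
proof -
  have "rad_norm K x = rad_norm K (\<lambda>k. \<Sum>l\<in>K. if k = l then x k else 0)"
    using assms by (intro rad_norm_cong) simp
  also have "\<dots> \<le> (\<Sum>l\<in>K. rad_norm K (\<lambda>k. if k = l then x k else 0))"
    by (rule rad_norm_sum)
  also have "\<dots> = (\<Sum>l\<in>K. norm (x l))"
  proof (intro sum.cong refl)
    fix l assume "l \<in> K"
    then have "rad_norm K (\<lambda>k. if k = l then x k else 0) = rad_norm {l} (\<lambda>k. if k = l then x k else 0)"
      using assms by (intro rad_norm_zero_ext) auto
    then show "rad_norm K (\<lambda>k. if k = l then x k else 0) = norm (x l)"
      by (simp add: rad_norm_singleton)
  qed
  finally show ?thesis .
qed

text \<open>The triangle inequality along a colouring of the index set. It separates residue classes
  mod 4 and, at the end, the few small indices from the others.\<close>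

lemma rad_norm_split:
  fixes c :: "'i \<Rightarrow> nat"
  assumes "finite K" "\<And>k. k \<in> K \<Longrightarrow> c k < n"
  shows "rad_norm K x \<le> (\<Sum>s<n. rad_norm {k\<in>K. c k = s} x)"
proof -
  have "rad_norm K x = rad_norm K (\<lambda>k. \<Sum>s<n. if c k = s then x k else 0)"
    using assms by (intro rad_norm_cong) simp
  also have "\<dots> \<le> (\<Sum>s<n. rad_norm K (\<lambda>k. if c k = s then x k else 0))"
    by (rule rad_norm_sum)
  also have "\<dots> = (\<Sum>s<n. rad_norm {k\<in>K. c k = s} x)"
  proof (intro sum.cong refl)
    fix s
    have "rad_norm K (\<lambda>k. if c k = s then x k else 0) =
        rad_norm {k\<in>K. c k = s} (\<lambda>k. if c k = s then x k else 0)"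
      using assms by (intro rad_norm_zero_ext) auto
    also have "\<dots> = rad_norm {k\<in>K. c k = s} x" by (intro rad_norm_cong) auto
    finally show "rad_norm K (\<lambda>k. if c k = s then x k else 0) = rad_norm {k\<in>K. c k = s} x" .
  qed
  finally show ?thesis .
qed

text \<open>R-boundedness expressed through sign averages, with the constant explicit so that it can
  be followed through compositions, sums and scalings. No linearity is built in, and a family may
  repeat an operator.\<close>

definition R_bd :: "real \<Rightarrow> ('a::real_normed_vector \<Rightarrow> 'b::real_normed_vector) set \<Rightarrow> bool"
  where "R_bd M F \<longleftrightarrow> 0 \<le> M \<and>
    (\<forall>K V x. finite K \<longrightarrow> K \<subseteq> {1::nat..} \<longrightarrow> (\<forall>k\<in>K. V k \<in> F) \<longrightarrow>
       rad_norm K (\<lambda>k. V k (x k)) \<le> M * rad_norm K x)"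

lemma R_bdI:
  assumes "0 \<le> M"
    and "\<And>(K::nat set) V x. finite K \<Longrightarrow> K \<subseteq> {1..} \<Longrightarrow> (\<And>k. k \<in> K \<Longrightarrow> V k \<in> F) \<Longrightarrow>
       rad_norm K (\<lambda>k. V k (x k)) \<le> M * rad_norm K x"
  shows "R_bd M F"
  using assms unfolding R_bd_def by blast

lemma R_bdD:
  assumes "R_bd M F" "finite (K::nat set)" "K \<subseteq> {1..}" "\<And>k. k \<in> K \<Longrightarrow> V k \<in> F"
  shows "rad_norm K (\<lambda>k. V k (x k)) \<le> M * rad_norm K x"
  using assms unfolding R_bd_def by blast

lemma R_bd_nonneg: "R_bd M F \<Longrightarrow> 0 \<le> M"
  unfolding R_bd_def by blast

lemma R_bd_subset: "R_bd M F \<Longrightarrow> G \<subseteq> F \<Longrightarrow> R_bd M G"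
  unfolding R_bd_def by blast

lemma R_bd_norm_le:
  assumes "R_bd M F" "f \<in> F"
  shows "norm (f x) \<le> M * norm x"
  using R_bdD[OF assms(1), of "{1}" "\<lambda>_. f" "\<lambda>_. x"] assms(2) by (simp add: rad_norm_singleton)

lemma R_bd_comp:
  fixes G :: "('a::real_normed_vector \<Rightarrow> 'b::real_normed_vector) set"
  assumes "R_bd M F" "R_bd M' G"
  shows "R_bd (M * M') {f \<circ> g |f g. f \<in> F \<and> g \<in> G}"
proof (rule R_bdI)
  show "0 \<le> M * M'" using assms by (simp add: R_bd_nonneg)
  fix K :: "nat set" and V and x :: "nat \<Rightarrow> 'a"
  assume K: "finite K" "K \<subseteq> {1..}" and "\<And>k. k \<in> K \<Longrightarrow> V k \<in> {f \<circ> g |f g. f \<in> F \<and> g \<in> G}"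
  then have "\<forall>k. \<exists>f g. k \<in> K \<longrightarrow> V k = f \<circ> g \<and> f \<in> F \<and> g \<in> G" by blast
  then obtain f g where fg: "\<And>k. k \<in> K \<Longrightarrow> V k = f k \<circ> g k \<and> f k \<in> F \<and> g k \<in> G" by metis
  have "rad_norm K (\<lambda>k. V k (x k)) = rad_norm K (\<lambda>k. f k (g k (x k)))"
    using fg by (intro rad_norm_cong) auto
  also have "\<dots> \<le> M * rad_norm K (\<lambda>k. g k (x k))"
    using fg by (intro R_bdD[OF assms(1) K]) auto
  also have "\<dots> \<le> M * (M' * rad_norm K x)"
    using fg R_bd_nonneg[OF assms(1)] by (intro mult_left_mono R_bdD[OF assms(2) K]) auto
  finally show "rad_norm K (\<lambda>k. V k (x k)) \<le> M * M' * rad_norm K x" by (simp add: mult.assoc)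
qed

lemma R_bd_add:
  assumes "R_bd M F" "R_bd M' G"
  shows "R_bd (M + M') {\<lambda>x. f x + g x |f g. f \<in> F \<and> g \<in> G}"
proof (rule R_bdI)
  show "0 \<le> M + M'" using assms by (simp add: R_bd_nonneg)
  fix K :: "nat set" and V and x :: "nat \<Rightarrow> 'a"
  assume K: "finite K" "K \<subseteq> {1..}" and "\<And>k. k \<in> K \<Longrightarrow> V k \<in> {\<lambda>x. f x + g x |f g. f \<in> F \<and> g \<in> G}"
  then have "\<forall>k. \<exists>f g. k \<in> K \<longrightarrow> V k = (\<lambda>x. f x + g x) \<and> f \<in> F \<and> g \<in> G" by blast
  then obtain f g where fg: "\<And>k. k \<in> K \<Longrightarrow> V k = (\<lambda>x. f k x + g k x) \<and> f k \<in> F \<and> g k \<in> G" by metis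
  have "rad_norm K (\<lambda>k. V k (x k)) = rad_norm K (\<lambda>k. f k (x k) + g k (x k))"
    using fg by (intro rad_norm_cong) auto
  also have "\<dots> \<le> rad_norm K (\<lambda>k. f k (x k)) + rad_norm K (\<lambda>k. g k (x k))"
    by (rule rad_norm_add)
  also have "\<dots> \<le> M * rad_norm K x + M' * rad_norm K x"
    using fg by (intro add_mono R_bdD[OF assms(1) K] R_bdD[OF assms(2) K]) auto
  finally show "rad_norm K (\<lambda>k. V k (x k)) \<le> (M + M') * rad_norm K x" by (simp add: algebra_simps)
qed

text \<open>The norm is convex in each single coordinate, so the coordinates are replaced one at a time.\<close>

lemma R_bd_convex:
  assumes "R_bd M F"
  shows "R_bd M {\<lambda>x. \<Sum>l\<in>L. c l *\<^sub>R f l x |(L::nat set) c f.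
    (\<forall>l\<in>L. 0 \<le> c l \<and> f l \<in> F) \<and> (\<Sum>l\<in>L. c l) = 1}" (is "R_bd M ?H")
proof (rule R_bdI)
  show "0 \<le> M" using assms by (rule R_bd_nonneg)
  fix K :: "nat set" and V and x :: "nat \<Rightarrow> 'a"
  assume K: "finite K" "K \<subseteq> {1..}" and V: "\<And>k. k \<in> K \<Longrightarrow> V k \<in> ?H"
  have "rad_norm K (\<lambda>k. V k (x k)) \<le> M * rad_norm K x"
    if "finite J" "J \<subseteq> K" "\<And>k. k \<in> J \<Longrightarrow> V k \<in> ?H" "\<And>k. k \<in> K - J \<Longrightarrow> V k \<in> F" for J V
    using that
  proof (induction J arbitrary: V rule: finite_induct)
    case empty
    then show ?case by (intro R_bdD[OF assms K]) auto
  next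
    case (insert k J)
    obtain L :: "nat set" and c f where Vk: "V k = (\<lambda>x. \<Sum>l\<in>L. c l *\<^sub>R f l x)"
      and L: "\<forall>l\<in>L. 0 \<le> c l \<and> f l \<in> F" and c1: "(\<Sum>l\<in>L. c l) = 1"
      using insert.prems(2)[of k] by blast
    \<comment> \<open>Since the weights sum to 1, averaging leaves the coordinates other than
      \<open>k\<close> unchanged, so the family is the convex combination of the families in which
      \<open>V k\<close> is replaced by \<open>f l\<close>. An infinite \<open>L\<close> cannot
      occur: its sum would be 0.\<close>
    have "rad_norm K (\<lambda>j. V j (x j)) = rad_norm K (\<lambda>j. \<Sum>l\<in>L. c l *\<^sub>R (V(k := f l)) j (x j))"
    proof (intro rad_norm_cong)
      fix j
      show "V j (x j) = (\<Sum>l\<in>L. c l *\<^sub>R (V(k := f l)) j (x j))"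
        using c1 by (cases "j = k") (auto simp: Vk scaleR_sum_left[symmetric])
    qed
    also have "\<dots> \<le> (\<Sum>l\<in>L. rad_norm K (\<lambda>j. c l *\<^sub>R (V(k := f l)) j (x j)))"
      by (rule rad_norm_sum)
    also have "\<dots> = (\<Sum>l\<in>L. c l * rad_norm K (\<lambda>j. (V(k := f l)) j (x j)))"
      using L by (intro sum.cong) (auto simp: rad_norm_scaleR)
    also have "\<dots> \<le> (\<Sum>l\<in>L. c l * (M * rad_norm K x))"
    proof (intro sum_mono mult_left_mono)
      fix l assume l: "l \<in> L"
      show "rad_norm K (\<lambda>j. (V(k := f l)) j (x j)) \<le> M * rad_norm K x"
      proof (rule insert.IH)
        fix j assume "j \<in> J" then show "(V(k := f l)) j \<in> ?H"
          using insert.hyps insert.prems(2)[of j] by (cases "j = k") simp_all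
      next
        fix j assume "j \<in> K - J" then show "(V(k := f l)) j \<in> F"
          using L l insert.prems(3)[of j] by auto
      qed (use insert.prems in auto)
    qed (use L in auto)
    also have "\<dots> = M * rad_norm K x" using c1 by (simp add: sum_distrib_right[symmetric])
    finally show ?case .
  qed
  from this[of K V] show "rad_norm K (\<lambda>k. V k (x k)) \<le> M * rad_norm K x"
    using K V by auto
qed

text \<open>The contraction principle for real scalars. Sign changes preserve
  \<open>rad_norm\<close>, and a number c in [-1, 1] is the convex combination of 1 and -1 with
  weights (1 + c)/2 and (1 - c)/2.\<close>

lemma R_bd_contraction: "R_bd 1 {\<lambda>x::'a::real_normed_vector. c *\<^sub>R x |c. \<bar>c\<bar> \<le> 1}"
proof (rule R_bd_subset)
  let ?F = "{\<lambda>x::'a. x, \<lambda>x. - x}"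
  have "R_bd 1 ?F"
  proof (rule R_bdI)
    fix K :: "nat set" and V and x :: "nat \<Rightarrow> 'a"
    assume V: "\<And>k. k \<in> K \<Longrightarrow> V k \<in> ?F"
    have "rad_norm K (\<lambda>k. V k (x k)) =
        rad_norm K (\<lambda>k. if k \<in> {k. V k = (\<lambda>x. - x)} then - x k else x k)"
    proof (intro rad_norm_cong)
      fix k assume "k \<in> K"
      then show "V k (x k) = (if k \<in> {k. V k = (\<lambda>x. - x)} then - x k else x k)"
        using V[of k] by auto
    qed
    then show "rad_norm K (\<lambda>k. V k (x k)) \<le> 1 * rad_norm K x"
      by (simp only: rad_norm_flip mult_1)
  qed simp
  then show "R_bd 1 {\<lambda>x. \<Sum>l\<in>L. c l *\<^sub>R f l x |(L::nat set) c f.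
    (\<forall>l\<in>L. 0 \<le> c l \<and> f l \<in> ?F) \<and> (\<Sum>l\<in>L. c l) = 1}" by (rule R_bd_convex)
  show "{\<lambda>x. c *\<^sub>R x |c. \<bar>c\<bar> \<le> 1} \<subseteq> {\<lambda>x. \<Sum>l\<in>L. c l *\<^sub>R f l x |(L::nat set) c f.
    (\<forall>l\<in>L. 0 \<le> c l \<and> f l \<in> ?F) \<and> (\<Sum>l\<in>L. c l) = 1}"
  proof clarify
    fix c :: real assume c: "\<bar>c\<bar> \<le> 1"
    define d where "d = (\<lambda>l::nat. if l = 0 then (1 + c) / 2 else (1 - c) / 2)"
    define f where "f = (\<lambda>l::nat. if l = 0 then (\<lambda>x::'a. x) else (\<lambda>x. - x))"
    have 1: "(\<lambda>x. c *\<^sub>R x) = (\<lambda>x. \<Sum>l\<in>{0,1}. d l *\<^sub>R f l x)"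
      unfolding d_def f_def
    proof
      fix x :: 'a
      have "c *\<^sub>R x = ((1 + c) / 2 - (1 - c) / 2) *\<^sub>R x" by (simp add: field_simps)
      also have "\<dots> = ((1 + c) / 2) *\<^sub>R x - ((1 - c) / 2) *\<^sub>R x"
        by (rule scaleR_left_diff_distrib)
      also have "\<dots> = (\<Sum>l\<in>{0::nat, 1}. (if l = 0 then (1 + c) / 2 else (1 - c) / 2) *\<^sub>R
          (if l = 0 then \<lambda>x. x else (\<lambda>x. - x)) x)"
        by simp
      finally show "c *\<^sub>R x = (\<Sum>l\<in>{0::nat, 1}. (if l = 0 then (1 + c) / 2 else (1 - c) / 2) *\<^sub>R
          (if l = 0 then \<lambda>x. x else (\<lambda>x. - x)) x)" .
    qed
    have 2: "(\<forall>l\<in>{0,1}. 0 \<le> d l \<and> f l \<in> ?F) \<and> (\<Sum>l\<in>{0,1}. d l) = 1"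
      unfolding d_def f_def using c by (auto simp: field_simps)
    show "\<exists>(L::nat set) e g. (\<lambda>x. c *\<^sub>R x) = (\<lambda>x. \<Sum>l\<in>L. e l *\<^sub>R g l x) \<and>
      (\<forall>l\<in>L. 0 \<le> e l \<and> g l \<in> ?F) \<and> (\<Sum>l\<in>L. e l) = 1"
      by (intro exI[of _ "{0, 1}"] exI[of _ d] exI[of _ f] conjI 1 2[THEN conjunct1] 2[THEN conjunct2])
  qed
qed

lemma R_bd_scale:
  assumes "R_bd M F" "0 \<le> c"
  shows "R_bd (c * M) {\<lambda>x. r *\<^sub>R f x |r f. \<bar>r\<bar> \<le> c \<and> f \<in> F}"
proof (rule R_bdI)
  show "0 \<le> c * M" using assms by (simp add: R_bd_nonneg)
  fix K :: "nat set" and V and x :: "nat \<Rightarrow> 'a"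
  assume K: "finite K" "K \<subseteq> {1..}"
    and "\<And>k. k \<in> K \<Longrightarrow> V k \<in> {\<lambda>x. r *\<^sub>R f x |r f. \<bar>r\<bar> \<le> c \<and> f \<in> F}"
  then have "\<forall>k. \<exists>r f. k \<in> K \<longrightarrow> V k = (\<lambda>x. r *\<^sub>R f x) \<and> \<bar>r\<bar> \<le> c \<and> f \<in> F" by blast
  then obtain r f where rf: "\<And>k. k \<in> K \<Longrightarrow> V k = (\<lambda>x. r k *\<^sub>R f k x) \<and> \<bar>r k\<bar> \<le> c \<and> f k \<in> F"
    by metis
  \<comment> \<open>If \<open>c = 0\<close>, every \<open>r k\<close> is 0 and
    \<open>r k / c\<close> is 0 as well, so the identity persists.\<close>
  have "rad_norm K (\<lambda>k. V k (x k)) = rad_norm K (\<lambda>k. c *\<^sub>R ((r k / c) *\<^sub>R f k (x k)))"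
    using rf \<open>0 \<le> c\<close> by (intro rad_norm_cong) (cases "c = 0", auto)
  also have "\<dots> = c * rad_norm K (\<lambda>k. (r k / c) *\<^sub>R f k (x k))"
    using \<open>0 \<le> c\<close> by (subst rad_norm_scaleR) simp
  also have "rad_norm K (\<lambda>k. (r k / c) *\<^sub>R f k (x k)) \<le> 1 * rad_norm K (\<lambda>k. f k (x k))"
  proof (rule R_bdD[OF R_bd_contraction K])
    fix k assume "k \<in> K"
    then have "\<bar>r k / c\<bar> \<le> 1" using rf[of k] \<open>0 \<le> c\<close> by (cases "c = 0") (auto simp: field_simps)
    then show "(\<lambda>x. (r k / c) *\<^sub>R x) \<in> {\<lambda>x. c *\<^sub>R x |c. \<bar>c\<bar> \<le> 1}" by blast
  qed
  also have "rad_norm K (\<lambda>k. f k (x k)) \<le> M * rad_norm K x"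
    using rf by (intro R_bdD[OF assms(1) K]) auto
  finally show "rad_norm K (\<lambda>k. V k (x k)) \<le> c * M * rad_norm K x"
    using \<open>0 \<le> c\<close> by (simp add: mult_left_mono mult.assoc)
qed

text \<open>Restriction to \<open>K\<close> multiplies by the scalars 0 and 1, a case of the
  contraction principle.\<close>

lemma rad_norm_mono:
  assumes "finite L" "L \<subseteq> {1::nat..}" "K \<subseteq> L"
  shows "rad_norm K x \<le> rad_norm L x"
proof -
  have "rad_norm K x = rad_norm K (\<lambda>k. of_bool (k \<in> K) *\<^sub>R x k)"
    by (intro rad_norm_cong) auto
  also have "\<dots> = rad_norm L (\<lambda>k. of_bool (k \<in> K) *\<^sub>R x k)"
    using assms by (intro rad_norm_zero_ext[symmetric]) auto
  also have "\<dots> \<le> 1 * rad_norm L x"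
  proof (rule R_bdD[OF R_bd_contraction assms(1,2)])
    fix k
    have "\<bar>of_bool (k \<in> K)::real\<bar> \<le> 1" by simp
    then show "(*\<^sub>R) (of_bool (k \<in> K)) \<in> {\<lambda>x. c *\<^sub>R x |c. \<bar>c\<bar> \<le> 1}" by blast
  qed
  finally show ?thesis by simp
qed

section \<open>Block sums of signs\<close>

text \<open>A further sign replaces X by X + c k or X - c k with equal weight, so odd terms cancel.
  The constant 3, that of a Gaussian fourth moment, survives the induction because 3 s^2 + 6 s (c
  k)^2 + (c k)^4 \<le> 3 (s + (c k)^2)^2.\<close>

lemma signed_sum_moments:
  fixes c :: "'i \<Rightarrow> real"
  assumes "finite J"
  shows "avg J (\<lambda>S. (signed_sum J S c)\<^sup>2) = (\<Sum>j\<in>J. (c j)\<^sup>2) \<and>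
    avg J (\<lambda>S. (signed_sum J S c) ^ 4) \<le> 3 * (\<Sum>j\<in>J. (c j)\<^sup>2)\<^sup>2"
  using assms
proof (induction J rule: finite_induct)
  case empty
  then show ?case by (simp add: avg_def signed_sum_def)
next
  case (insert k J)
  let ?X = "\<lambda>S. signed_sum J S c"
  define s where "s = (\<Sum>j\<in>J. (c j)\<^sup>2)"
  have split: "avg (insert k J) (\<lambda>S. (signed_sum (insert k J) S c) ^ p) =
      avg J (\<lambda>S. (1 / 2) * ((?X S - c k) ^ p + (?X S + c k) ^ p))" for p
  proof -
    have "avg (insert k J) (\<lambda>S. (signed_sum (insert k J) S c) ^ p) =
        (avg J (\<lambda>S. (?X S - c k) ^ p) + avg J (\<lambda>S. (?X S + c k) ^ p)) / 2"
      unfolding avg_insert[OF insert.hyps]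
      using insert.hyps
      by (intro arg_cong2[where f="(/)"] arg_cong2[where f="(+)"] refl avg_cong)
        (auto simp: signed_sum_insert signed_sum_insert2 add.commute subset_iff)
    then show ?thesis by (simp only: avg_cmult avg_add)
  qed
  have "avg (insert k J) (\<lambda>S. (signed_sum (insert k J) S c)\<^sup>2) = avg J (\<lambda>S. (?X S)\<^sup>2 + (c k)\<^sup>2)"
    unfolding split by (intro avg_cong) (simp add: power2_eq_square algebra_simps)
  also have "\<dots> = s + (c k)\<^sup>2"
    using insert.IH insert.hyps by (simp add: avg_add avg_const s_def)
  finally have 2: "avg (insert k J) (\<lambda>S. (signed_sum (insert k J) S c)\<^sup>2) = s + (c k)\<^sup>2" .
  have "avg (insert k J) (\<lambda>S. (signed_sum (insert k J) S c) ^ 4) =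
      avg J (\<lambda>S. (?X S) ^ 4 + ((6 * (c k)\<^sup>2) * (?X S)\<^sup>2 + (c k) ^ 4))"
    unfolding split by (intro avg_cong) (simp add: power4_eq_xxxx power2_eq_square algebra_simps)
  also have "\<dots> = avg J (\<lambda>S. (?X S) ^ 4) + (6 * (c k)\<^sup>2 * s + (c k) ^ 4)"
    using insert.IH insert.hyps by (simp add: avg_add avg_const avg_cmult s_def)
  also have "\<dots> \<le> 3 * s\<^sup>2 + (6 * (c k)\<^sup>2 * s + (c k) ^ 4)"
    using insert.IH by (simp add: s_def)
  also have "\<dots> \<le> 3 * (s + (c k)\<^sup>2)\<^sup>2"
    using zero_le_even_power[of 4 "c k"] by (simp add: power4_eq_xxxx power2_eq_square algebra_simps)
  finally show ?case
    using 2 insert.hyps by (simp add: s_def add.commute)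
qed

text \<open>The absolute value is bounded below by an even quartic polynomial, whose average is
  controlled by the second and fourth moments. This gives the constant that interpolation between
  the first, second and fourth moments would give.\<close>

lemma khintchine_L1_lower:
  fixes c :: "'i \<Rightarrow> real"
  assumes "finite J"
  shows "sqrt ((\<Sum>j\<in>J. (c j)\<^sup>2) / 3) \<le> avg J (\<lambda>S. \<bar>signed_sum J S c\<bar>)"
proof (cases "(\<Sum>j\<in>J. (c j)\<^sup>2) = 0")
  case True
  then show ?thesis by (simp only: div_0 real_sqrt_zero) (intro avg_nonneg, simp)
next
  case False
  define s where "s = (\<Sum>j\<in>J. (c j)\<^sup>2)"
  have "s > 0" using False unfolding s_def by (simp add: less_le sum_nonneg)
  \<comment> \<open>The point where the quartic touches the absolute value. The resulting lower
    bound 3 s / (2 d) - 3 s^2 / (2 d^3) is largest for d^2 = 3 s, with value d / 3.\<close>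
  define d where "d = sqrt (3 * s)"
  have d: "d > 0" "d\<^sup>2 = 3 * s" using \<open>s > 0\<close> by (simp_all add: d_def)
  let ?X = "\<lambda>S. signed_sum J S c"
  have pointwise: "(3 / (2 * d)) * t\<^sup>2 + (- 1 / (2 * d ^ 3)) * t ^ 4 \<le> \<bar>t\<bar>" for t
  proof -
    define u where "u = \<bar>t\<bar> / d"
    have "u \<ge> 0" using d by (simp add: u_def)
    have t: "t\<^sup>2 = d\<^sup>2 * u\<^sup>2" "t ^ 4 = d ^ 4 * u ^ 4" "\<bar>t\<bar> = d * u"
      using d(1) by (simp_all add: u_def power_divide)
    have "0 \<le> d * ((u / 2) * ((u - 1)\<^sup>2 * (u + 2)))"
      using \<open>u \<ge> 0\<close> d by simp
    also have "\<dots> = d * (u - 3 / 2 * u\<^sup>2 + u ^ 4 / 2)"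
      by (simp add: power4_eq_xxxx power2_eq_square field_simps)
    also have "\<dots> = d * u - (3 / (2 * d)) * (d\<^sup>2 * u\<^sup>2) + (1 / (2 * d ^ 3)) * (d ^ 4 * u ^ 4)"
      using d(1) by (simp add: power4_eq_xxxx power2_eq_square power3_eq_cube field_simps)
    finally show ?thesis unfolding t by simp
  qed
  have "sqrt (s / 3) = d / 3"
  proof (rule real_sqrt_unique)
    show "(d / 3)\<^sup>2 = s / 3" using d by (simp add: power_divide)
  qed (use d in simp)
  also have "d / 3 = (3 / (2 * d)) * s + (- 1 / (2 * d ^ 3)) * (3 * s\<^sup>2)"
  proof -
    have s: "s = d * d / 3" using d by (simp add: power2_eq_square)
    show ?thesis unfolding s using d(1) by (simp add: field_simps power2_eq_square power3_eq_cube)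
  qed
  also have "\<dots> \<le> (3 / (2 * d)) * avg J (\<lambda>S. (?X S)\<^sup>2) + (- 1 / (2 * d ^ 3)) * avg J (\<lambda>S. (?X S) ^ 4)"
    unfolding signed_sum_moments[OF assms, THEN conjunct1] s_def[symmetric]
    using signed_sum_moments[OF assms, of c] d(1)
    by (intro add_left_mono mult_left_mono_neg) (simp_all add: s_def)
  also have "\<dots> = avg J (\<lambda>S. (3 / (2 * d)) * (?X S)\<^sup>2 + (- 1 / (2 * d ^ 3)) * (?X S) ^ 4)"
    by (simp only: avg_add avg_cmult)
  also have "\<dots> \<le> avg J (\<lambda>S. \<bar>?X S\<bar>)"
    by (intro avg_mono pointwise)
  finally show ?thesis unfolding s_def .
qed

text \<open>The sum of the signs over a block of size \<open>N\<close> is a symmetric random variable of mean absolute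
  value at least \<open>sqrt (N / 3)\<close>, so by convexity independent block sums dominate independent signs.\<close>

lemma rad_norm_blocks:
  fixes z :: "nat \<Rightarrow> 'a::real_normed_vector" and g :: "nat \<Rightarrow> nat"
  assumes K: "finite K" "K \<subseteq> {1..}" and J: "finite J" "g ` J \<subseteq> K"
    and card: "\<And>k. k \<in> K \<Longrightarrow> card {j\<in>J. g j = k} = N" and "N > 0"
  shows "rad_norm K z \<le> sqrt (3 / real N) * rad_norm J (\<lambda>j. z (g j))"
proof -
  define \<xi> where "\<xi> S k = signed_sum J S (\<lambda>j. of_bool (g j = k) :: real)" for S k
  define m where "m k = avg J (\<lambda>S. \<bar>\<xi> S k\<bar>)" for k
  have m: "sqrt (real N / 3) \<le> m k" if "k \<in> K" for k
  proof -
    have "(\<Sum>j\<in>J. (of_bool (g j = k))\<^sup>2) = (\<Sum>j\<in>J. if g j = k then 1 else 0 :: real)"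
      by (intro sum.cong) auto
    also have "\<dots> = (\<Sum>j\<in>{j\<in>J. g j = k}. 1)"
      using J(1) by (rule sum.inter_filter[symmetric])
    also have "\<dots> = real N" using card[OF that] by simp
    finally show ?thesis
      unfolding m_def \<xi>_def using khintchine_L1_lower[OF J(1), of "\<lambda>j. of_bool (g j = k)"] by simp
  qed
  \<comment> \<open>A second sign pattern \<open>R\<close> acts on whole blocks. Summing over each
    block first, the sum over \<open>J\<close> becomes a signed sum over \<open>K\<close> with
    coefficients \<open>\<xi> S k\<close>, the sums of signs in the blocks.\<close>
  have group: "signed_sum J S (\<lambda>j. if j \<in> {j. g j \<notin> R} then - z (g j) else z (g j)) =
      signed_sum K R (\<lambda>k. \<xi> S k *\<^sub>R z k)" for S R
  proof -
    let ?h = "\<lambda>j. if j \<in> S then (if j \<in> {j. g j \<notin> R} then - z (g j) else z (g j))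
      else - (if j \<in> {j. g j \<notin> R} then - z (g j) else z (g j))"
    have "(\<Sum>j\<in>{j\<in>J. g j = k}. ?h j) = (if k \<in> R then \<xi> S k *\<^sub>R z k else - (\<xi> S k *\<^sub>R z k))" for k
    proof -
      have "\<xi> S k = (\<Sum>j\<in>J. if g j = k then (if j \<in> S then 1 else -1) else 0)"
        unfolding \<xi>_def signed_sum_def by (intro sum.cong) auto
      also have "\<dots> = (\<Sum>j\<in>{j\<in>J. g j = k}. if j \<in> S then 1 else -1)"
        using J(1) by (rule sum.inter_filter[symmetric])
      finally have \<xi>: "\<xi> S k = (\<Sum>j\<in>{j\<in>J. g j = k}. if j \<in> S then 1 else -1)" .
      show ?thesis
        unfolding \<xi> scaleR_sum_left sum_negf[symmetric]
        by (cases "k \<in> R") (auto intro!: sum.cong)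
    qed
    then show ?thesis
      unfolding signed_sum_def sum.group[OF J(1) K(1) J(2), of ?h, symmetric] by simp
  qed
  \<comment> \<open>The average of \<open>\<xi> S k\<close> over \<open>S\<close> vanishes; only
    after its sign has been absorbed by a flip is there a coefficient with positive mean.\<close>
  have abs: "rad_norm K (\<lambda>k. \<xi> S k *\<^sub>R z k) = rad_norm K (\<lambda>k. \<bar>\<xi> S k\<bar> *\<^sub>R z k)" for S
  proof -
    have "rad_norm K (\<lambda>k. \<xi> S k *\<^sub>R z k) =
        rad_norm K (\<lambda>k. if k \<in> {k. \<xi> S k < 0} then - (\<xi> S k *\<^sub>R z k) else \<xi> S k *\<^sub>R z k)"
      by (rule rad_norm_flip[symmetric])
    also have "\<dots> = rad_norm K (\<lambda>k. \<bar>\<xi> S k\<bar> *\<^sub>R z k)"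
      by (intro rad_norm_cong) auto
    finally show ?thesis .
  qed
  \<comment> \<open>Flipping whole blocks does not change the left side, so it may be averaged over
    \<open>R\<close> at no cost. Exchanging the two averages leaves, for each fixed
    \<open>S\<close>, independent signs on \<open>K\<close> with known coefficients.\<close>
  have "(rad_norm J (\<lambda>j. z (g j)))\<^sup>2 = avg K (\<lambda>R. (rad_norm J (\<lambda>j. z (g j)))\<^sup>2)"
    using K(1) by (simp add: avg_const)
  also have "\<dots> = avg K (\<lambda>R. (rad_norm J (\<lambda>j. if j \<in> {j. g j \<notin> R} then - z (g j) else z (g j)))\<^sup>2)"
    by (simp only: rad_norm_flip)
  also have "\<dots> = avg J (\<lambda>S. avg K (\<lambda>R. (norm (signed_sum K R (\<lambda>k. \<xi> S k *\<^sub>R z k)))\<^sup>2))"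
    unfolding rad_norm_squared group by (rule avg_swap)
  also have "\<dots> = avg J (\<lambda>S. (rad_norm K (\<lambda>k. \<bar>\<xi> S k\<bar> *\<^sub>R z k))\<^sup>2)"
    unfolding rad_norm_squared[symmetric] abs ..
  finally have eq: "(rad_norm J (\<lambda>j. z (g j)))\<^sup>2 = avg J (\<lambda>S. (rad_norm K (\<lambda>k. \<bar>\<xi> S k\<bar> *\<^sub>R z k))\<^sup>2)" .
  \<comment> \<open>Jensen's inequality: the mean coefficients come out by convexity of
    \<open>rad_norm\<close>, and the mean of a quantity is at most its quadratic mean.\<close>
  have "rad_norm K (\<lambda>k. m k *\<^sub>R z k) =
      rad_norm K (\<lambda>k. \<Sum>S\<in>Pow J. (1 / 2 ^ card J) *\<^sub>R (\<bar>\<xi> S k\<bar> *\<^sub>R z k))"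
    unfolding m_def avg_def by (simp add: scaleR_sum_left[symmetric] sum_divide_distrib)
  also have "\<dots> \<le> (\<Sum>S\<in>Pow J. rad_norm K (\<lambda>k. (1 / 2 ^ card J) *\<^sub>R (\<bar>\<xi> S k\<bar> *\<^sub>R z k)))"
    by (rule rad_norm_sum)
  also have "\<dots> = avg J (\<lambda>S. rad_norm K (\<lambda>k. \<bar>\<xi> S k\<bar> *\<^sub>R z k))"
    unfolding rad_norm_scaleR avg_def by (simp add: sum_divide_distrib)
  also have "\<dots> \<le> rad_norm J (\<lambda>j. z (g j))"
    by (rule power2_le_imp_le) (simp_all add: eq power2_avg_le[OF J(1)])
  finally have le: "rad_norm K (\<lambda>k. m k *\<^sub>R z k) \<le> rad_norm J (\<lambda>j. z (g j))" .
  let ?c = "sqrt (real N / 3)"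
  have "?c > 0" using \<open>N > 0\<close> by simp
  have "?c * rad_norm K z = rad_norm K (\<lambda>k. ?c *\<^sub>R z k)"
    using \<open>?c > 0\<close> by (simp only: rad_norm_scaleR abs_of_pos)
  \<comment> \<open>The means \<open>m k\<close> are only known to be at least \<open>?c\<close>;
    the contraction principle replaces them by this common value.\<close>
  also have "\<dots> = rad_norm K (\<lambda>k. (?c / m k) *\<^sub>R (m k *\<^sub>R z k))"
    using m \<open>?c > 0\<close> by (intro rad_norm_cong) force
  also have "\<dots> \<le> 1 * rad_norm K (\<lambda>k. m k *\<^sub>R z k)"
  proof (rule R_bdD[OF R_bd_contraction K])
    fix k assume "k \<in> K"
    then have "0 < m k" "?c \<le> m k" using m[of k] \<open>?c > 0\<close> by linarith+
    then have "\<bar>?c / m k\<bar> \<le> 1" by simp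
    then show "(\<lambda>x::'a. (?c / m k) *\<^sub>R x) \<in> {\<lambda>x. c *\<^sub>R x |c. \<bar>c\<bar> \<le> 1}" by blast
  qed
  finally have "?c * rad_norm K z \<le> rad_norm J (\<lambda>j. z (g j))" using le by simp
  then have "rad_norm K z \<le> rad_norm J (\<lambda>j. z (g j)) / ?c"
    using \<open>?c > 0\<close> by (simp add: pos_le_divide_eq mult.commute)
  also have "\<dots> = sqrt (3 / real N) * rad_norm J (\<lambda>j. z (g j))"
    by (simp add: real_sqrt_divide)
  finally show ?thesis .
qed

section \<open>Rademacher sums on a probability space\<close>

lemma simple_function_scaleR:
  assumes "simple_function P f" "simple_function P g"
  shows "simple_function P (\<lambda>u. f u *\<^sub>R g u)"
  using assms by (rule simple_function_compose2)

lemma strongly_measurable_norm: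
  assumes "strongly_measurable P f"
  shows "(\<lambda>u. norm (f u)) \<in> borel_measurable P"
proof -
  obtain s where s: "\<And>i. simple_function P (s i)" and lim: "\<And>u. u \<in> space P \<Longrightarrow> (\<lambda>i. s i u) \<longlonglongrightarrow> f u"
    using assms unfolding strongly_measurable_def by blast
  show ?thesis
  proof (rule borel_measurable_LIMSEQ_metric)
    show "(\<lambda>u. norm (s i u)) \<in> borel_measurable P" for i
      by (rule borel_measurable_simple_function, rule simple_function_compose1, rule s)
    show "(\<lambda>i. norm (s i u)) \<longlonglongrightarrow> norm (f u)" if "u \<in> space P" for u
      by (intro tendsto_norm lim that)
  qed
qed

lemma strongly_measurable_diff:
  assumes "strongly_measurable P f" "strongly_measurable P g"
  shows "strongly_measurable P (\<lambda>u. f u - g u)"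
proof -
  obtain s t where "\<And>i. simple_function P (s i)" "\<And>u. u \<in> space P \<Longrightarrow> (\<lambda>i. s i u) \<longlonglongrightarrow> f u"
    "\<And>i. simple_function P (t i)" "\<And>u. u \<in> space P \<Longrightarrow> (\<lambda>i. t i u) \<longlonglongrightarrow> g u"
    using assms unfolding strongly_measurable_def by blast
  then show ?thesis
    unfolding strongly_measurable_def
    by (intro exI[of _ "\<lambda>i u. s i u - t i u"]) (auto intro!: tendsto_diff)
qed

lemma rademacher_measurable:
  assumes "rademacher_sequence P \<epsilon>" "k \<ge> 1"
  shows "\<epsilon> k \<in> borel_measurable P"
proof -
  interpret prob_space P using assms by (simp add: rademacher_sequence_def)
  have "indep_vars (\<lambda>_. borel) \<epsilon> {1..}" using assms(1) by (simp add: rademacher_sequence_def)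
  then show ?thesis using assms(2) by (simp add: indep_vars_def2)
qed

lemma strongly_measurable_rademacher_sum:
  fixes x :: "nat \<Rightarrow> 'a::complex_banach"
  assumes "rademacher_sequence P \<epsilon>" "K \<subseteq> {1..}"
  shows "strongly_measurable P (\<lambda>u. \<Sum>k\<in>K. \<epsilon> k u *\<^sub>R x k)"
proof -
  have "\<exists>s. (\<forall>i. simple_function P (s i)) \<and> (\<forall>u\<in>space P. (\<lambda>i. s i u) \<longlonglongrightarrow> \<epsilon> k u)" if "k \<in> K" for k
  proof -
    have "\<epsilon> k \<in> borel_measurable P" using assms that by (intro rademacher_measurable) auto
    from borel_measurable_implies_sequence_metric[OF this, of 0] show ?thesis by blast
  qed
  then obtain s where "\<And>k i. k \<in> K \<Longrightarrow> simple_function P (s k i)"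
    "\<And>k u. k \<in> K \<Longrightarrow> u \<in> space P \<Longrightarrow> (\<lambda>i. s k i u) \<longlonglongrightarrow> \<epsilon> k u" by metis
  then show ?thesis
    unfolding strongly_measurable_def
    by (intro exI[of _ "\<lambda>i u. \<Sum>k\<in>K. s k i u *\<^sub>R x k"])
      (auto intro!: tendsto_sum tendsto_scaleR simple_function_scaleR)
qed

lemma rademacher_AE:
  assumes "rademacher_sequence P \<epsilon>"
  shows "AE u in P. \<forall>k\<ge>1. \<epsilon> k u = 1 \<or> \<epsilon> k u = -1"
proof -
  interpret prob_space P using assms by (simp add: rademacher_sequence_def)
  have "AE u in P. k \<ge> 1 \<longrightarrow> \<epsilon> k u = 1 \<or> \<epsilon> k u = -1" for k
  proof (cases "k \<ge> 1")
    case True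
    note [measurable] = rademacher_measurable[OF assms True]
    let ?A = "\<lambda>s. {u \<in> space P. \<epsilon> k u = s}"
    have "prob (?A 1 \<union> ?A (-1)) = prob (?A 1) + prob (?A (-1))"
      by (intro finite_measure_Union) auto
    also have "\<dots> = 1 / 2 + 1 / 2" using assms True by (simp only: rademacher_sequence_def)
    finally have "prob (?A 1 \<union> ?A (-1)) = 1" by simp
    then have "AE u in P. u \<in> ?A 1 \<union> ?A (-1)" by (rule AE_prob_1)
    then show ?thesis by eventually_elim auto
  qed simp
  then show ?thesis by (simp add: AE_all_countable)
qed

lemma rademacher_pattern:
  assumes "rademacher_sequence P \<epsilon>" "finite K" "K \<subseteq> {1..}"
  shows "measure P {u\<in>space P. \<forall>k\<in>K. \<epsilon> k u = (if k \<in> S then 1 else -1)} = 1 / 2 ^ card K"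
proof (cases "K = {}")
  case True
  interpret prob_space P using assms by (simp add: rademacher_sequence_def)
  show ?thesis using True by (simp add: prob_space)
next
  case False
  interpret prob_space P using assms by (simp add: rademacher_sequence_def)
  define A where "A k = \<epsilon> k -` {if k \<in> S then 1 else -1} \<inter> space P" for k
  have A: "A k = {u\<in>space P. \<epsilon> k u = (if k \<in> S then 1 else -1)}" for k unfolding A_def by auto
  have "indep_sets (\<lambda>k. {\<epsilon> k -` B \<inter> space P |B. B \<in> sets borel}) {1..}"
    using assms by (simp add: rademacher_sequence_def indep_vars_def2)
  then have "prob (\<Inter>k\<in>K. A k) = (\<Prod>k\<in>K. prob (A k))"
  proof (rule indep_setsD)
    show "\<forall>k\<in>K. A k \<in> {\<epsilon> k -` B \<inter> space P |B. B \<in> sets borel}"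
    proof
      fix k
      show "A k \<in> {\<epsilon> k -` B \<inter> space P |B. B \<in> sets borel}"
        unfolding A_def by (rule CollectI, rule exI[of _ "{if k \<in> S then 1 else -1}"]) simp
    qed
  qed (rule assms False)+
  also have "\<dots> = (\<Prod>k\<in>K. 1 / 2)"
  proof (rule prod.cong[OF refl])
    fix k assume "k \<in> K"
    then have "k \<ge> 1" using assms(3) by auto
    then show "prob (A k) = 1 / 2"
      using assms(1) unfolding A rademacher_sequence_def by (cases "k \<in> S") simp_all
  qed
  also have "(\<Inter>k\<in>K. A k) = {u\<in>space P. \<forall>k\<in>K. \<epsilon> k u = (if k \<in> S then 1 else -1)}"
    using False unfolding A by auto
  finally show ?thesis by (simp add: power_one_over)
qed

text \<open>Almost surely exactly one event \<open>E S\<close> occurs, and on it the sum equals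
  \<open>signed_sum K S x\<close>. The integrand is thus a step function, and by independence each
  event has mass 2^(- card K).\<close>

lemma rademacher_sum_square:
  fixes x :: "nat \<Rightarrow> 'a::complex_banach"
  assumes "rademacher_sequence P \<epsilon>" "finite K" "K \<subseteq> {1..}"
  shows "has_bochner_integral P (\<lambda>u. (norm (\<Sum>k\<in>K. \<epsilon> k u *\<^sub>R x k))\<^sup>2) ((rad_norm K x)\<^sup>2)"
proof -
  interpret prob_space P using assms by (simp add: rademacher_sequence_def)
  define E where "E S = {u\<in>space P. \<forall>k\<in>K. \<epsilon> k u = (if k \<in> S then 1 else -1)}" for S
  have meas: "\<epsilon> k \<in> borel_measurable P" if "k \<in> K" for k
    using rademacher_measurable[OF assms(1)] assms(3) that by auto
  have E_meas: "E S \<in> sets P" for S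
    unfolding E_def using assms(2) meas by (intro sets.sets_Collect_finite_All) auto
  have "has_bochner_integral P (\<lambda>u. \<Sum>S\<in>Pow K. (norm (signed_sum K S x))\<^sup>2 * indicator (E S) u)
      (\<Sum>S\<in>Pow K. (norm (signed_sum K S x))\<^sup>2 * measure P (E S))"
    using E_meas
    by (intro has_bochner_integral_sum has_bochner_integral_mult_right has_bochner_integral_real_indicator)
      (auto simp: less_top[symmetric])
  also have "(\<Sum>S\<in>Pow K. (norm (signed_sum K S x))\<^sup>2 * measure P (E S)) = (rad_norm K x)\<^sup>2"
    unfolding E_def rademacher_pattern[OF assms] rad_norm_squared avg_def
    by (simp add: sum_divide_distrib)
  finally have "has_bochner_integral P (\<lambda>u. \<Sum>S\<in>Pow K. (norm (signed_sum K S x))\<^sup>2 * indicator (E S) u)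
    ((rad_norm K x)\<^sup>2)" .
  moreover have "AE u in P. (\<Sum>S\<in>Pow K. (norm (signed_sum K S x))\<^sup>2 * indicator (E S) u) =
      (norm (\<Sum>k\<in>K. \<epsilon> k u *\<^sub>R x k))\<^sup>2"
    using rademacher_AE[OF assms(1)] AE_space
  proof eventually_elim
    case (elim u)
    define R where "R = {k\<in>K. \<epsilon> k u = 1}"
    have "u \<in> E S \<longleftrightarrow> S = R" if "S \<subseteq> K" for S
    proof
      assume "u \<in> E S"
      then show "S = R" using that unfolding E_def R_def by (auto split: if_splits)
    next
      assume "S = R"
      then show "u \<in> E S" using elim assms(3) unfolding E_def R_def by fastforce
    qed
    then have "(\<Sum>S\<in>Pow K. (norm (signed_sum K S x))\<^sup>2 * indicator (E S) u) =
        (\<Sum>S\<in>Pow K. if S = R then (norm (signed_sum K S x))\<^sup>2 else 0)"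
      by (intro sum.cong) (auto simp: indicator_def)
    also have "\<dots> = (norm (signed_sum K R x))\<^sup>2"
      using assms(2) by (simp add: R_def)
    also have "signed_sum K R x = (\<Sum>k\<in>K. \<epsilon> k u *\<^sub>R x k)"
      unfolding signed_sum_def
    proof (intro sum.cong refl)
      fix k assume "k \<in> K"
      then show "(if k \<in> R then x k else - x k) = \<epsilon> k u *\<^sub>R x k"
        using elim(1) assms(3) by (cases "k \<in> R") (auto simp: R_def)
    qed
    finally show ?case .
  qed
  ultimately show ?thesis
    by (subst has_bochner_integral_cong_AE[symmetric])
      (auto intro!: borel_measurable_power strongly_measurable_norm
        strongly_measurable_rademacher_sum assms intro: borel_measurable_has_bochner_integral)
qed

lemma L2_norm_rademacher_sum:
  fixes x :: "nat \<Rightarrow> 'a::complex_banach"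
  assumes "rademacher_sequence P \<epsilon>" "finite K" "K \<subseteq> {1..}"
  shows "L2_norm P (\<lambda>u. \<Sum>k\<in>K. \<epsilon> k u *\<^sub>R x k) = rad_norm K x"
  using has_bochner_integral_integral_eq[OF rademacher_sum_square[OF assms, of x]]
  by (simp add: L2_norm_def)

lemma L2_norm_rad_sum:
  assumes "rademacher_sequence P \<epsilon>"
  shows "L2_norm P (rad_sum \<epsilon> n x) = rad_norm {1..n} x"
proof -
  have "rad_sum \<epsilon> n x = (\<lambda>u. \<Sum>k=1..n. \<epsilon> k u *\<^sub>R x k)"
    by (rule ext) (simp add: rad_sum_def)
  then show ?thesis using L2_norm_rademacher_sum[OF assms, of "{1..n}" x] by auto
qed

text \<open>The hypothesis speaks of initial segments only. Gaps of \<open>K\<close> are filled with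
  some operator of the family applied to 0, which contributes nothing because the operators are
  linear.\<close>

lemma R_bounded_imp_R_bd:
  fixes F :: "('a::complex_banach \<Rightarrow> 'b::complex_banach) set"
  assumes "rademacher_sequence P \<epsilon>" "R_bounded P \<epsilon> F"
  obtains M where "R_bd M F"
proof -
  obtain M where "M \<ge> 0" and M: "\<And>n V x. (\<forall>k\<in>{1..n}. V k \<in> F) \<Longrightarrow>
      L2_norm P (rad_sum \<epsilon> n (\<lambda>k. V k (x k))) \<le> M * L2_norm P (rad_sum \<epsilon> n x)"
    and lin: "\<And>V. V \<in> F \<Longrightarrow> bounded_clinear V"
    using assms(2) unfolding R_bounded_def by blast
  have "R_bd M F"
  proof (rule R_bdI)
    fix K :: "nat set" and V and x :: "nat \<Rightarrow> 'a"
    assume K: "finite K" "K \<subseteq> {1..}" and V: "\<And>k. k \<in> K \<Longrightarrow> V k \<in> F"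
    show "rad_norm K (\<lambda>k. V k (x k)) \<le> M * rad_norm K x"
    proof (cases "K = {}")
      case True
      then show ?thesis by (simp add: rad_norm_def avg_def signed_sum_def)
    next
      case False
      then obtain k0 where k0: "k0 \<in> K" by blast
      define W where "W k = (if k \<in> K then V k else V k0)" for k
      define y where "y k = (if k \<in> K then x k else 0)" for k
      have W: "W k \<in> F" for k unfolding W_def using V k0 by auto
      have W0: "W k 0 = 0" for k
        using lin[OF W[of k]] unfolding bounded_clinear_def by (simp add: linear_simps(3))
      have sub: "K \<subseteq> {1..Max K}" using K by auto
      have "rad_norm K (\<lambda>k. V k (x k)) = rad_norm K (\<lambda>k. W k (y k))"
        by (intro rad_norm_cong) (simp add: W_def y_def)
      also have "\<dots> = rad_norm {1..Max K} (\<lambda>k. W k (y k))"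
        using sub by (intro rad_norm_zero_ext[symmetric]) (auto simp: y_def W0)
      also have "\<dots> \<le> M * rad_norm {1..Max K} y"
        using M[of "Max K" W y] W by (simp add: L2_norm_rad_sum[OF assms(1)])
      also have "rad_norm {1..Max K} y = rad_norm K y"
        using sub by (intro rad_norm_zero_ext) (auto simp: y_def)
      also have "rad_norm K y = rad_norm K x" by (intro rad_norm_cong) (simp add: y_def)
      finally show ?thesis .
    qed
  qed fact
  then show ?thesis by (rule that)
qed

text \<open>The inequality (a + b)^2 \<le> 2 a^2 + 2 b^2 takes the place of Minkowski's. Its weaker
  constants suffice for proving uniform bounds and convergence to 0.\<close>

lemma square_integrable_diff:
  assumes "strongly_measurable P f" "strongly_measurable P g"
    and "integrable P (\<lambda>u. (norm (f u))\<^sup>2)" "integrable P (\<lambda>u. (norm (g u))\<^sup>2)"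
  shows "integrable P (\<lambda>u. (norm (f u - g u))\<^sup>2)"
    and "(L2_norm P (\<lambda>u. f u - g u))\<^sup>2 \<le> 2 * (L2_norm P f)\<^sup>2 + 2 * (L2_norm P g)\<^sup>2"
proof -
  have le: "(norm (f u - g u))\<^sup>2 \<le> 2 * (norm (f u))\<^sup>2 + 2 * (norm (g u))\<^sup>2" for u
  proof -
    have "(norm (f u - g u))\<^sup>2 \<le> (norm (f u) + norm (g u))\<^sup>2"
      by (intro power_mono norm_triangle_ineq4) auto
    also have "\<dots> \<le> 2 * (norm (f u))\<^sup>2 + 2 * (norm (g u))\<^sup>2"
      using zero_le_power2[of "norm (f u) - norm (g u)"]
      by (simp add: power2_eq_square algebra_simps)
    finally show ?thesis .
  qed
  have int: "integrable P (\<lambda>u. 2 * (norm (f u))\<^sup>2 + 2 * (norm (g u))\<^sup>2)"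
    using assms by (intro Bochner_Integration.integrable_add integrable_mult_right) auto
  show 1: "integrable P (\<lambda>u. (norm (f u - g u))\<^sup>2)"
  proof (rule Bochner_Integration.integrable_bound[OF int])
    show "(\<lambda>u. (norm (f u - g u))\<^sup>2) \<in> borel_measurable P"
      using assms by (intro borel_measurable_power strongly_measurable_norm strongly_measurable_diff)
  qed (use le in simp)
  have sq: "(L2_norm P h)\<^sup>2 = (\<integral>u. (norm (h u))\<^sup>2 \<partial>P)" for h :: "'a \<Rightarrow> 'b"
    by (simp add: L2_norm_def)
  have "(L2_norm P (\<lambda>u. f u - g u))\<^sup>2 \<le> (\<integral>u. 2 * (norm (f u))\<^sup>2 + 2 * (norm (g u))\<^sup>2 \<partial>P)"
    unfolding sq by (intro integral_mono 1 int le)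
  also have "\<dots> = 2 * (L2_norm P f)\<^sup>2 + 2 * (L2_norm P g)\<^sup>2"
    unfolding sq using assms by (subst Bochner_Integration.integral_add) auto
  finally show "(L2_norm P (\<lambda>u. f u - g u))\<^sup>2 \<le> 2 * (L2_norm P f)\<^sup>2 + 2 * (L2_norm P g)\<^sup>2" .
qed

text \<open>Norms of partial sums increase with n, so each is bounded through the limit. The factor
  2 is the constant sqrt 2 of the preceding inequality, rounded up.\<close>

lemma rad_sums_bound:
  fixes z :: "nat \<Rightarrow> 'a::complex_banach"
  assumes rs: "rademacher_sequence P \<epsilon>" and f: "rad_sums P \<epsilon> z f"
  shows "rad_norm {1..n} z \<le> 2 * L2_norm P f"
    and "e > 0 \<Longrightarrow> \<exists>p0\<ge>1. \<forall>p\<ge>p0. \<forall>q. rad_norm {p..q} z < e"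
proof -
  define d where "d n = (L2_norm P (\<lambda>u. rad_sum \<epsilon> n z u - f u))\<^sup>2" for n
  have "d \<longlonglongrightarrow> 0\<^sup>2"
    unfolding d_def using f by (intro tendsto_power) (simp add: rad_sums_def)
  then have d0: "d \<longlonglongrightarrow> 0" by simp
  have fm: "strongly_measurable P f" "integrable P (\<lambda>u. (norm (f u))\<^sup>2)"
    using f by (auto simp: rad_sums_def Rad_def bochner_L2_def)
  have Sm: "strongly_measurable P (rad_sum \<epsilon> n z)" "integrable P (\<lambda>u. (norm (rad_sum \<epsilon> n z u))\<^sup>2)" for n
  proof -
    have eq: "rad_sum \<epsilon> n z = (\<lambda>u. \<Sum>k=1..n. \<epsilon> k u *\<^sub>R z k)"
      by (rule ext) (simp add: rad_sum_def)
    show "strongly_measurable P (rad_sum \<epsilon> n z)"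
      unfolding eq by (intro strongly_measurable_rademacher_sum rs) auto
    show "integrable P (\<lambda>u. (norm (rad_sum \<epsilon> n z u))\<^sup>2)"
      unfolding eq using rademacher_sum_square[OF rs, of "{1..n}" z]
      by (auto intro: has_bochner_integral_integrable integrable.intros)
  qed
  have dm: "strongly_measurable P (\<lambda>u. rad_sum \<epsilon> n z u - f u)"
    "integrable P (\<lambda>u. (norm (rad_sum \<epsilon> n z u - f u))\<^sup>2)" for n
    by (intro strongly_measurable_diff square_integrable_diff Sm fm)+
  have 1: "(rad_norm {1..n} z)\<^sup>2 \<le> 2 * d n + 2 * (L2_norm P f)\<^sup>2" for n
  proof -
    \<comment> \<open>Written as (S_n - f) - (0 - f), the partial sum is bounded by its distance to
      f and the norm of f.\<close>
    have mf: "strongly_measurable P (\<lambda>u. 0 - f u)" "integrable P (\<lambda>u. (norm (0 - f u))\<^sup>2)"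
      by (intro strongly_measurable_diff fm) (auto simp: strongly_measurable_def fm)
    have "(L2_norm P (\<lambda>u. (rad_sum \<epsilon> n z u - f u) - (0 - f u)))\<^sup>2 \<le> 2 * d n + 2 * (L2_norm P (\<lambda>u. 0 - f u))\<^sup>2"
      unfolding d_def by (intro square_integrable_diff dm mf)
    also have "L2_norm P (\<lambda>u. 0 - f u) = L2_norm P f" by (simp add: L2_norm_def)
    also have "(\<lambda>u. (rad_sum \<epsilon> n z u - f u) - (0 - f u)) = rad_sum \<epsilon> n z" by simp
    finally show ?thesis by (simp add: L2_norm_rad_sum[OF rs])
  qed
  have 2: "(rad_norm {p..q} z)\<^sup>2 \<le> 2 * d q + 2 * d (p - 1)" if "1 \<le> p" "p \<le> q" for p q
  proof -
    have "(L2_norm P (\<lambda>u. (rad_sum \<epsilon> q z u - f u) - (rad_sum \<epsilon> (p - 1) z u - f u)))\<^sup>2 \<le> 2 * d q + 2 * d (p - 1)"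
      unfolding d_def by (intro square_integrable_diff dm)
    also have "(\<lambda>u. (rad_sum \<epsilon> q z u - f u) - (rad_sum \<epsilon> (p - 1) z u - f u)) =
        (\<lambda>u. \<Sum>k=p..q. \<epsilon> k u *\<^sub>R z k)"
    proof
      fix u
      have "{1..q} = {1..p-1} \<union> {p..q}" using that by auto
      then have "rad_sum \<epsilon> q z u = rad_sum \<epsilon> (p - 1) z u + (\<Sum>k=p..q. \<epsilon> k u *\<^sub>R z k)"
        unfolding rad_sum_def using that by (simp only:) (subst sum.union_disjoint; auto)
      then show "(rad_sum \<epsilon> q z u - f u) - (rad_sum \<epsilon> (p - 1) z u - f u) = (\<Sum>k=p..q. \<epsilon> k u *\<^sub>R z k)"
        by simp
    qed
    also have "L2_norm P \<dots> = rad_norm {p..q} z"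
      using that by (intro L2_norm_rademacher_sum rs) auto
    finally show ?thesis .
  qed
  show "rad_norm {1..n} z \<le> 2 * L2_norm P f"
  proof -
    have "(rad_norm {1..n} z)\<^sup>2 \<le> 2 * 0 + 2 * (L2_norm P f)\<^sup>2"
    proof (rule tendsto_lowerbound)
      show "(\<lambda>m. 2 * d m + 2 * (L2_norm P f)\<^sup>2) \<longlonglongrightarrow> 2 * 0 + 2 * (L2_norm P f)\<^sup>2"
        by (intro tendsto_intros d0)
      show "\<forall>\<^sub>F m in sequentially. (rad_norm {1..n} z)\<^sup>2 \<le> 2 * d m + 2 * (L2_norm P f)\<^sup>2"
        using eventually_ge_at_top[of n]
      proof eventually_elim
        case (elim m)
        have "(rad_norm {1..n} z)\<^sup>2 \<le> (rad_norm {1..m} z)\<^sup>2"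
          using elim by (intro power_mono rad_norm_mono) auto
        then show ?case using 1[of m] by (rule order_trans)
      qed
    qed simp
    also have "\<dots> \<le> (2 * L2_norm P f)\<^sup>2" by (simp add: power_mult_distrib)
    finally show ?thesis by (rule power2_le_imp_le) (simp add: L2_norm_def)
  qed
  show "\<exists>p0\<ge>1. \<forall>p\<ge>p0. \<forall>q. rad_norm {p..q} z < e" if "e > 0"
  proof -
    have "\<forall>\<^sub>F n in sequentially. d n < e\<^sup>2 / 4"
      using d0 \<open>e > 0\<close> by (intro order_tendstoD(2)[OF d0]) simp
    then obtain N where N: "\<And>n. n \<ge> N \<Longrightarrow> d n < e\<^sup>2 / 4" by (auto simp: eventually_sequentially)
    have "rad_norm {p..q} z < e" if "p \<ge> N + 1" for p q
    proof (cases "p \<le> q")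
      case True
      have "(rad_norm {p..q} z)\<^sup>2 < e\<^sup>2"
      proof -
        have "N \<le> q" "N \<le> p - 1" "1 \<le> p" using that True by linarith+
        then have "d q < e\<^sup>2 / 4" "d (p - 1) < e\<^sup>2 / 4" using N by blast+
        then show ?thesis using 2[OF \<open>1 \<le> p\<close> True] by linarith
      qed
      then show ?thesis using \<open>e > 0\<close> by (simp add: power2_less_imp_less)
    next
      case False
      then show ?thesis using \<open>e > 0\<close> by (simp add: rad_norm_def avg_def signed_sum_def)
    qed
    then show ?thesis by (intro exI[of _ "N + 1"]) auto
  qed
qed

text \<open>A Riesz-Fischer argument: a rapidly Cauchy subsequence of the partial sums converges
  almost everywhere, and Fatou's lemma turns its limit into an L^2 limit. Bounds pass through Fatou
  unchanged, so \<open>B\<close> is kept.\<close>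

lemma rad_sums_complete:
  fixes a :: "nat \<Rightarrow> 'a::complex_banach"
  assumes rs: "rademacher_sequence P \<epsilon>"
    and cauchy: "\<And>e. e > 0 \<Longrightarrow> \<exists>p0\<ge>1. \<forall>p\<ge>p0. \<forall>q. rad_norm {p..q} a < e"
    and bound: "\<And>n. rad_norm {1..n} a \<le> B"
  shows "\<exists>f. rad_sums P \<epsilon> a f \<and> L2_norm P f \<le> B"
proof -
  interpret prob_space P using rs by (simp add: rademacher_sequence_def)
  \<comment> \<open>The variables may take other values than 1 and -1 on a null set. Resetting them
    to 0 there makes every partial sum a simple function.\<close>
  define e where "e k u = (if \<epsilon> k u = 1 then 1 else if \<epsilon> k u = -1 then -1 else (0::real))" for k u
  define S where "S m u = (\<Sum>k=1..m. e k u *\<^sub>R a k)" for m u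
  have e_simple: "simple_function P (e k)" if "k \<ge> 1" for k
  proof -
    note [measurable] = rademacher_measurable[OF rs that]
    show ?thesis unfolding e_def by (intro simple_function_If simple_function_const) measurable
  qed
  have S_simple: "simple_function P (S m)" for m
    unfolding S_def by (intro simple_function_sum simple_function_scaleR e_simple simple_function_const) auto
  have diff_simple: "simple_function P (\<lambda>u. norm (S q u - S p u))" for p q
    by (rule simple_function_compose2[OF S_simple S_simple])
  have AE_S: "AE u in P. \<forall>m. S m u = rad_sum \<epsilon> m a u"
    using rademacher_AE[OF rs]
    by eventually_elim (auto simp: S_def rad_sum_def e_def intro!: sum.cong)
  have S_int: "has_bochner_integral P (\<lambda>u. (norm (S q u - S p u))\<^sup>2) ((rad_norm {p+1..q} a)\<^sup>2)"
    if "p \<le> q" for p q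
  proof -
    have "AE u in P. (norm (\<Sum>k=p+1..q. \<epsilon> k u *\<^sub>R a k))\<^sup>2 = (norm (S q u - S p u))\<^sup>2"
      using AE_S
    proof eventually_elim
      case (elim u)
      have "{1..q} = {1..p} \<union> {p+1..q}" using that by auto
      then have "rad_sum \<epsilon> q a u = rad_sum \<epsilon> p a u + (\<Sum>k=p+1..q. \<epsilon> k u *\<^sub>R a k)"
        unfolding rad_sum_def by (simp only:) (subst sum.union_disjoint; auto)
      then show ?case using elim by simp
    qed
    moreover have "has_bochner_integral P (\<lambda>u. (norm (\<Sum>k=p+1..q. \<epsilon> k u *\<^sub>R a k))\<^sup>2) ((rad_norm {p+1..q} a)\<^sup>2)"
      by (intro rademacher_sum_square rs) auto
    moreover have "(\<lambda>u. (norm (S q u - S p u))\<^sup>2) \<in> borel_measurable P"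
      by (rule borel_measurable_simple_function, rule simple_function_compose1[OF diff_simple])
    ultimately show ?thesis
      using has_bochner_integral_cong_AE borel_measurable_has_bochner_integral by blast
  qed
  have "\<forall>i. \<exists>p0\<ge>1. \<forall>p\<ge>p0. \<forall>q. rad_norm {p..q} a < (1/2) ^ i"
    by (intro allI cauchy) simp
  then obtain N where N: "\<And>i p q. p \<ge> N i \<Longrightarrow> rad_norm {p..q} a < (1/2) ^ i" by metis
  \<comment> \<open>The sum makes \<open>n\<close> monotone and at least \<open>N i\<close>; the
    summand \<open>i\<close> makes it pass any given index.\<close>
  define n where "n i = i + (\<Sum>j\<le>i. N j)" for i
  have n_mono: "n i \<le> n (Suc i)" and n_ge: "N i \<le> n i" "i \<le> n i" for i
    unfolding n_def by (auto intro: member_le_sum trans_le_add2)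
  \<comment> \<open>For an increment of norm t, 2^i t^2 + 2^(-i) dominates t, while its integral is
    at most 2 times 2^(-i), as the L^2 norm of the increment is below 2^(-i). Square integrals alone
    thus yield absolute convergence almost everywhere.\<close>
  define h where "h i u = 2 ^ i * (norm (S (n (Suc i)) u - S (n i) u))\<^sup>2 + (1/2) ^ i" for i u
  have h_nonneg: "0 \<le> h i u" for i u unfolding h_def by simp
  have h_meas: "h i \<in> borel_measurable P" for i
    unfolding h_def by (intro borel_measurable_add borel_measurable_times borel_measurable_power
      borel_measurable_simple_function diff_simple) auto
  have h_int: "(\<integral>\<^sup>+u. ennreal (h i u) \<partial>P) \<le> ennreal (2 * (1/2) ^ i)" for i
  proof -
    let ?r = "rad_norm {n i + 1..n (Suc i)} a"
    have int: "has_bochner_integral P (h i) (2 ^ i * ?r\<^sup>2 + (1/2) ^ i)"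
      unfolding h_def
      by (intro has_bochner_integral_add has_bochner_integral_mult_right S_int n_mono)
        (auto simp: has_bochner_integral_iff prob_space)
    then have "(\<integral>\<^sup>+u. ennreal (h i u) \<partial>P) = ennreal (2 ^ i * ?r\<^sup>2 + (1/2) ^ i)"
      by (subst nn_integral_eq_integral) (auto simp: has_bochner_integral_iff h_nonneg)
    also have "\<dots> \<le> ennreal (2 * (1/2) ^ i)"
    proof (rule ennreal_leI)
      have "?r \<le> (1/2) ^ i" using N[of i "n i + 1" "n (Suc i)"] n_ge(1)[of i] by simp
      then have "2 ^ i * ?r\<^sup>2 \<le> 2 ^ i * ((1/2) ^ i)\<^sup>2" by (intro mult_left_mono power_mono) auto
      also have "\<dots> = (1/2) ^ i" by (simp add: power2_eq_square power_one_over)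
      finally show "2 ^ i * ?r\<^sup>2 + (1/2) ^ i \<le> 2 * (1/2) ^ i" by simp
    qed
    finally show ?thesis .
  qed
  have "AE u in P. (\<Sum>i. ennreal (h i u)) \<noteq> \<infinity>"
  proof (rule nn_integral_PInf_AE)
    show "(\<lambda>u. \<Sum>i. ennreal (h i u)) \<in> borel_measurable P"
      using h_meas by measurable
    have "(\<integral>\<^sup>+u. (\<Sum>i. ennreal (h i u)) \<partial>P) = (\<Sum>i. \<integral>\<^sup>+u. ennreal (h i u) \<partial>P)"
      using h_meas by (intro nn_integral_suminf) auto
    also have "\<dots> \<le> (\<Sum>i. ennreal (2 * (1/2) ^ i))"
      by (intro suminf_le h_int summableI)
    also have "\<dots> = ennreal (\<Sum>i. 2 * (1/2) ^ i)"
      by (intro suminf_ennreal2 summable_mult summable_geometric) auto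
    finally show "(\<integral>\<^sup>+u. (\<Sum>i. ennreal (h i u)) \<partial>P) \<noteq> \<infinity>"
      by (auto simp: top_unique)
  qed
  then obtain Z where Z: "{u\<in>space P. \<not> (\<Sum>i. ennreal (h i u)) \<noteq> \<infinity>} \<subseteq> Z" "emeasure P Z = 0" "Z \<in> sets P"
    by (rule AE_E)
  \<comment> \<open>Strong measurability demands convergence at every point, so the approximants are
    set to 0 on the exceptional null set \<open>Z\<close>.\<close>
  define s where "s i u = (if u \<in> Z then 0 else S (n i) u)" for i u
  define f where "f u = lim (\<lambda>i. s i u)" for u
  have s_simple: "simple_function P (s i)" for i
    unfolding s_def using Z by (intro simple_function_If_set S_simple) auto
  have s_lim: "(\<lambda>i. s i u) \<longlonglongrightarrow> f u" if u: "u \<in> space P" for u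
  proof (cases "u \<in> Z")
    case True
    then show ?thesis by (simp add: f_def s_def)
  next
    case False
    then have "(\<Sum>i. ennreal (h i u)) \<noteq> top" using Z(1) u by auto
    then have sm: "summable (\<lambda>i. h i u)" using h_nonneg by (intro summable_suminf_not_top)
    have "summable (\<lambda>i. S (n (Suc i)) u - S (n i) u)"
    proof (rule summable_norm_cancel, rule summable_comparison_test'[OF sm])
      fix i :: nat
      let ?t = "norm (S (n (Suc i)) u - S (n i) u)"
      have "0 \<le> (1/2) ^ i * ((2 ^ i * ?t - 1)\<^sup>2 + 2 ^ i * ?t)" by simp
      also have "\<dots> = h i u - ?t"
        unfolding h_def by (simp add: power2_eq_square algebra_simps power_one_over)
      finally show "norm (norm (S (n (Suc i)) u - S (n i) u)) \<le> h i u" by simp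
    qed
    then have "(\<lambda>m. \<Sum>i<m. S (n (Suc i)) u - S (n i) u) \<longlonglongrightarrow> (\<Sum>i. S (n (Suc i)) u - S (n i) u)"
      by (rule summable_LIMSEQ)
    then have "(\<lambda>m. S (n m) u - S (n 0) u) \<longlonglongrightarrow> (\<Sum>i. S (n (Suc i)) u - S (n i) u)"
      by (simp only: sum_lessThan_telescope[of "\<lambda>m. S (n m) u"])
    from tendsto_add[OF this tendsto_const[of "S (n 0) u"]]
    have "convergent (\<lambda>m. S (n m) u)" by (auto simp: convergent_def)
    then show ?thesis using False by (simp add: f_def s_def convergent_LIMSEQ_iff)
  qed
  have f_meas: "strongly_measurable P f"
    unfolding strongly_measurable_def using s_simple s_lim by blast
  have rad_meas: "strongly_measurable P (rad_sum \<epsilon> m a)" for m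
  proof -
    have "rad_sum \<epsilon> m a = (\<lambda>u. \<Sum>k=1..m. \<epsilon> k u *\<^sub>R a k)" by (rule ext) (simp add: rad_sum_def)
    then show ?thesis by (simp only:) (intro strongly_measurable_rademacher_sum rs, auto)
  qed
  \<comment> \<open>Fatou along the subsequence: for large i the distance from \<open>s i\<close> to
    the m-th sum is a \<open>rad_norm\<close> over \<open>{m+1..n i}\<close>. The case m = 0 bounds
    \<open>f\<close> itself, large m gives convergence.\<close>
  have dist: "integrable P (\<lambda>u. (norm (f u - rad_sum \<epsilon> m a u))\<^sup>2) \<and>
      L2_norm P (\<lambda>u. f u - rad_sum \<epsilon> m a u) \<le> c" if c: "\<And>q. rad_norm {m+1..q} a \<le> c" for m c
  proof -
    have "c \<ge> 0" using c[of 0] rad_norm_nonneg[of "{m+1..0}" a] by linarith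
    have meas: "(\<lambda>u. (norm (f u - rad_sum \<epsilon> m a u))\<^sup>2) \<in> borel_measurable P"
      by (intro borel_measurable_power strongly_measurable_norm strongly_measurable_diff f_meas rad_meas)
    have s_meas: "strongly_measurable P (s i)" for i
      unfolding strongly_measurable_def using s_simple by (intro exI[of _ "\<lambda>_. s i"]) auto
    have sd_meas: "(\<lambda>u. (norm (s i u - rad_sum \<epsilon> m a u))\<^sup>2) \<in> borel_measurable P" for i
      by (intro borel_measurable_power strongly_measurable_norm strongly_measurable_diff s_meas rad_meas)
    have "(\<integral>\<^sup>+u. ennreal ((norm (f u - rad_sum \<epsilon> m a u))\<^sup>2) \<partial>P) =
        (\<integral>\<^sup>+u. liminf (\<lambda>i. ennreal ((norm (s i u - rad_sum \<epsilon> m a u))\<^sup>2)) \<partial>P)"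
    proof (rule nn_integral_cong)
      fix u assume u: "u \<in> space P"
      have "(\<lambda>i. ennreal ((norm (s i u - rad_sum \<epsilon> m a u))\<^sup>2)) \<longlonglongrightarrow>
          ennreal ((norm (f u - rad_sum \<epsilon> m a u))\<^sup>2)"
        by (intro tendsto_ennrealI tendsto_intros s_lim u)
      then show "ennreal ((norm (f u - rad_sum \<epsilon> m a u))\<^sup>2) =
          liminf (\<lambda>i. ennreal ((norm (s i u - rad_sum \<epsilon> m a u))\<^sup>2))"
        by (intro lim_imp_Liminf[symmetric]) auto
    qed
    also have "\<dots> \<le> liminf (\<lambda>i. \<integral>\<^sup>+u. ennreal ((norm (s i u - rad_sum \<epsilon> m a u))\<^sup>2) \<partial>P)"
      using sd_meas by (intro nn_integral_liminf) auto
    also have "\<dots> \<le> liminf (\<lambda>i::nat. ennreal (c\<^sup>2))"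
    proof (rule Liminf_mono)
      show "\<forall>\<^sub>F i in sequentially. (\<integral>\<^sup>+u. ennreal ((norm (s i u - rad_sum \<epsilon> m a u))\<^sup>2) \<partial>P) \<le> ennreal (c\<^sup>2)"
        using eventually_ge_at_top[of m]
      proof eventually_elim
        case (elim i)
        then have "m \<le> n i" using n_ge(2)[of i] by linarith
        have "AE u in P. u \<notin> Z" using Z by (intro AE_not_in) auto
        with AE_S have "AE u in P. ennreal ((norm (s i u - rad_sum \<epsilon> m a u))\<^sup>2) =
            ennreal ((norm (S (n i) u - S m u))\<^sup>2)"
          by eventually_elim (simp add: s_def)
        then have "(\<integral>\<^sup>+u. ennreal ((norm (s i u - rad_sum \<epsilon> m a u))\<^sup>2) \<partial>P) =
            (\<integral>\<^sup>+u. ennreal ((norm (S (n i) u - S m u))\<^sup>2) \<partial>P)" by (rule nn_integral_cong_AE)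
        also have "\<dots> = ennreal ((rad_norm {m+1..n i} a)\<^sup>2)"
          using S_int[OF \<open>m \<le> n i\<close>] by (subst nn_integral_eq_integral) (auto simp: has_bochner_integral_iff)
        also have "\<dots> \<le> ennreal (c\<^sup>2)" by (intro ennreal_leI power_mono c) simp
        finally show ?case .
      qed
    qed
    also have "\<dots> = ennreal (c\<^sup>2)" by (intro Liminf_const) simp
    finally have le: "(\<integral>\<^sup>+u. ennreal ((norm (f u - rad_sum \<epsilon> m a u))\<^sup>2) \<partial>P) \<le> ennreal (c\<^sup>2)" .
    then have int: "integrable P (\<lambda>u. (norm (f u - rad_sum \<epsilon> m a u))\<^sup>2)"
      by (intro integrableI_nonneg meas) (auto simp: less_top[symmetric] top_unique)
    then have "ennreal (\<integral>u. (norm (f u - rad_sum \<epsilon> m a u))\<^sup>2 \<partial>P) \<le> ennreal (c\<^sup>2)"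
      using le by (subst (asm) nn_integral_eq_integral) auto
    then have "(\<integral>u. (norm (f u - rad_sum \<epsilon> m a u))\<^sup>2 \<partial>P) \<le> c\<^sup>2"
      by (subst (asm) ennreal_le_iff) auto
    then have "L2_norm P (\<lambda>u. f u - rad_sum \<epsilon> m a u) \<le> c"
      unfolding L2_norm_def using \<open>c \<ge> 0\<close> by (intro real_le_lsqrt) auto
    with int show ?thesis by blast
  qed
  have f0: "integrable P (\<lambda>u. (norm (f u))\<^sup>2)" "L2_norm P f \<le> B"
    using dist[of 0 B] bound by (simp_all add: rad_sum_def)
  have conv: "\<exists>m0. \<forall>m\<ge>m0. L2_norm P (\<lambda>u. f u - rad_sum \<epsilon> m a u) < r" if "r > 0" for r
  proof -
    obtain p0 where p0: "\<And>p q. p \<ge> p0 \<Longrightarrow> rad_norm {p..q} a < r / 2"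
      using cauchy[of "r / 2"] \<open>r > 0\<close> by auto
    have "L2_norm P (\<lambda>u. f u - rad_sum \<epsilon> m a u) < r" if "m \<ge> p0" for m
    proof -
      have "L2_norm P (\<lambda>u. f u - rad_sum \<epsilon> m a u) \<le> r / 2"
        using that p0[of "m + 1"] by (intro dist[THEN conjunct2]) (simp add: less_imp_le)
      then show ?thesis using \<open>r > 0\<close> by simp
    qed
    then show ?thesis by blast
  qed
  have "f \<in> Rad P \<epsilon>"
    unfolding Rad_def bochner_L2_def using f_meas f0 conv by blast
  moreover have "(\<lambda>m. L2_norm P (\<lambda>u. rad_sum \<epsilon> m a u - f u)) \<longlonglongrightarrow> 0"
  proof (rule LIMSEQ_I)
    fix r :: real assume "r > 0"
    have "L2_norm P (\<lambda>u. rad_sum \<epsilon> m a u - f u) = L2_norm P (\<lambda>u. f u - rad_sum \<epsilon> m a u)" for m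
      by (simp add: L2_norm_def norm_minus_commute)
    moreover have "0 \<le> L2_norm P (\<lambda>u. f u - rad_sum \<epsilon> m a u)" for m
      by (simp add: L2_norm_def)
    ultimately show "\<exists>m0. \<forall>m\<ge>m0. norm (L2_norm P (\<lambda>u. rad_sum \<epsilon> m a u - f u) - 0) < r"
      using conv[OF \<open>r > 0\<close>] by simp
  qed
  ultimately show ?thesis
    using f0(2) unfolding rad_sums_def by blast
qed

section \<open>Decay of the observed orbits\<close>

lemma funpow_commute:
  fixes f g :: "'a \<Rightarrow> 'a"
  assumes "\<And>x. f (g x) = g (f x)"
  shows "(f ^^ p) ((g ^^ l) x) = (g ^^ l) ((f ^^ p) x)"
proof -
  have *: "f ((g ^^ l) x) = (g ^^ l) (f x)" for x
    by (induction l) (simp_all add: assms)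
  show ?thesis by (induction p) (simp_all add: *)
qed

lemma funpow_left_inverse:
  fixes f g :: "'a \<Rightarrow> 'a"
  assumes "\<And>x. g (f x) = x"
  shows "(g ^^ p) ((f ^^ p) x) = x"
proof (induction p arbitrary: x)
  case (Suc p)
  have "(g ^^ Suc p) ((f ^^ Suc p) x) = g ((g ^^ p) ((f ^^ p) (f x)))"
    by (simp add: funpow_swap1)
  then show ?case using Suc.IH assms by simp
qed simp

lemma bounded_linear_funpow:
  fixes T :: "'a::real_normed_vector \<Rightarrow> 'a"
  shows "bounded_linear T \<Longrightarrow> bounded_linear (T ^^ k)"
proof (induction k)
  case 0
  then show ?case by (simp add: id_def bounded_linear_ident)
next
  case (Suc k)
  then show ?case by (simp add: bounded_linear_compose comp_def)
qed

lemma R_bd_funpow: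
  fixes F :: "('a::real_normed_vector \<Rightarrow> 'a) set"
  assumes "R_bd M F"
  shows "R_bd (M ^ p) {f ^^ p |f. f \<in> F}"
proof (induction p)
  case 0
  have "{f ^^ 0 |f. f \<in> F} \<subseteq> {\<lambda>x. c *\<^sub>R x |c. \<bar>c\<bar> \<le> 1}"
    by (auto simp: id_def intro!: exI[of _ 1])
  with R_bd_contraction show ?case by (simp only: power_0) (rule R_bd_subset)
next
  case (Suc p)
  have "{f ^^ Suc p |f. f \<in> F} \<subseteq> {f \<circ> g |f g. f \<in> F \<and> g \<in> {f ^^ p |f. f \<in> F}}"
    by auto
  with R_bd_comp[OF assms Suc.IH] show ?case by (simp only: power_Suc) (rule R_bd_subset)
qed

text \<open>Where I - rT is injective, \<open>inv\<close> is a left inverse. Injectivity follows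
  from power boundedness: a vector y with y = r T y also equals r^k T^k y, which tends to 0.\<close>

lemma resolvent_at_left_inverse:
  fixes T :: "'a::complex_banach \<Rightarrow> 'a"
  assumes T: "bounded_linear T" and pb: "\<And>k x. norm ((T ^^ k) x) \<le> M * norm x"
    and r: "0 \<le> r" "r < 1"
  shows "resolvent_at T (of_real r) (x - r *\<^sub>R T x) = x"
proof -
  have "inj (\<lambda>x. x - of_real r *\<^sub>C T x)"
  proof (rule injI)
    fix x y assume "x - of_real r *\<^sub>C T x = y - of_real r *\<^sub>C T y"
    then have z: "x - y = r *\<^sub>R T (x - y)"
      using T by (simp add: scaleR_eq_scaleC[symmetric] linear_simps scaleR_diff_right algebra_simps)
    have pow: "x - y = r ^ k *\<^sub>R (T ^^ k) (x - y)" for k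
    proof (induction k)
      case (Suc k)
      have "x - y = r *\<^sub>R T (x - y)" by (rule z)
      also have "\<dots> = r *\<^sub>R T (r ^ k *\<^sub>R (T ^^ k) (x - y))" using Suc.IH by simp
      also have "\<dots> = r ^ Suc k *\<^sub>R (T ^^ Suc k) (x - y)" using T by (simp add: linear_simps)
      finally show ?case .
    qed simp
    have "norm (x - y) \<le> 0"
    proof (rule LIMSEQ_le_const)
      have "(\<lambda>k. r ^ k * (M * norm (x - y))) \<longlonglongrightarrow> 0 * (M * norm (x - y))"
        using r by (intro tendsto_mult LIMSEQ_realpow_zero tendsto_const) auto
      then show "(\<lambda>k. r ^ k * (M * norm (x - y))) \<longlonglongrightarrow> 0" by simp
      have "norm (x - y) \<le> r ^ k * (M * norm (x - y))" for k
      proof -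
        have "norm (x - y) = r ^ k * norm ((T ^^ k) (x - y))"
          using r by (subst pow[of k]) simp
        then show ?thesis using pb[of k "x - y"] r by (simp add: mult_left_mono)
      qed
      then show "\<exists>N. \<forall>k\<ge>N. norm (x - y) \<le> r ^ k * (M * norm (x - y))" by blast
    qed
    then show "x = y" by simp
  qed
  from inv_f_f[OF this, of x] show ?thesis
    unfolding resolvent_at_def by (simp add: scaleR_eq_scaleC)
qed

lemma scaled_family_memI:
  assumes "\<bar>r\<bar> \<le> c" "f \<in> F"
  shows "(\<lambda>x. r *\<^sub>R f x) \<in> {\<lambda>x. r *\<^sub>R f x |r f. \<bar>r\<bar> \<le> c \<and> f \<in> F}"
  using assms by blast

text \<open>Each of the \<open>m + 1\<close> factors \<open>I - rT\<close> that undo the resolvent is paired with about \<open>n / (m + 1)\<close> of the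
  powers of \<open>T\<close>, and is then of order \<open>1 / n\<close>.\<close>

lemma R_bd_observed_powers:
  fixes T :: "'a::complex_banach \<Rightarrow> 'a" and C :: "'a \<Rightarrow> 'b::complex_banach"
  assumes T: "bounded_linear T"
    and M0: "R_bd M0 {T ^^ k |k. k \<ge> 0}"
    and M1: "R_bd M1 {\<lambda>x. real k *\<^sub>R ((T ^^ k) x - (T ^^ (k - 1)) x) |k. k \<ge> 1}"
    and C: "bounded_linear C" and \<beta>: "\<beta> > -1" and m: "real m = (\<alpha> + \<beta>) / 2"
    and M2: "R_bd M2 {\<lambda>x. (1 - (cmod \<omega>)\<^sup>2) powr ((1 + \<beta>) / 2) *\<^sub>R C ((resolvent_at T \<omega> ^^ (m + 1)) x)
        |\<omega>. cmod \<omega> < 1}" (is "R_bd M2 ?F")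
    and lin: "\<And>\<omega>. cmod \<omega> < 1 \<Longrightarrow> bounded_linear
        (\<lambda>x. (1 - (cmod \<omega>)\<^sup>2) powr ((1 + \<beta>) / 2) *\<^sub>R C ((resolvent_at T \<omega> ^^ (m + 1)) x))"
  obtains M where "R_bd M {\<lambda>x. real n powr ((1 + \<alpha>) / 2) *\<^sub>R C ((T ^^ (n - 1)) x) |n. n \<ge> 1}"
proof -
  \<comment> \<open>Division with remainder, n - 1 = (m+1) l + t: the power T^(n-1) splits into m +
    1 copies of T^l and a rest T^t.\<close>
  define l where "l n = (n - 1) div (m + 1)" for n
  define r where "r n = 1 - 1 / real n" for n
  define f where "f n x = x - r n *\<^sub>R T x" for n x
  define G where "G n x = real n *\<^sub>R (T ^^ l n) (f n x)" for n x
  let ?P = "{T ^^ k |k. k \<ge> 0}"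
  let ?D = "{\<lambda>x. real k *\<^sub>R ((T ^^ k) x - (T ^^ (k - 1)) x) |k. k \<ge> 1}"
  have Tk: "bounded_linear (T ^^ k)" for k using T by (rule bounded_linear_funpow)
  have r: "0 \<le> r n" "r n < 1" if "n \<ge> 1" for n using that by (auto simp: r_def)
  have l: "real n \<le> real (m + 1) * real (l n + 1)" for n
  proof -
    have "n - 1 < (m + 1) * (l n + 1)"
      unfolding l_def using dividend_less_times_div[of "m + 1" "n - 1"] by (simp add: algebra_simps)
    then have "n \<le> (m + 1) * (l n + 1)" by linarith
    then show ?thesis by (simp only: of_nat_mult[symmetric] of_nat_le_iff)
  qed
  have fT: "f n (T x) = T (f n x)" for n x unfolding f_def using T by (simp add: linear_simps)
  have G_lin: "bounded_linear (G n)" for n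
    unfolding G_def f_def
    by (intro bounded_linear_compose[OF bounded_linear_scaleR_right] bounded_linear_compose[OF Tk]
        bounded_linear_sub bounded_linear_ident T)
  \<comment> \<open>Indeed n (T^l - r T^(l+1)) = n (1 - r) T^l - r n (T^(l+1) - T^l), and n (1 - r)
    = 1 by the choice of r. The second term is the Ritt operator of index l + 1 with a factor r n /
    (l + 1), in modulus at most m + 1.\<close>
  have G_eq: "G n = (\<lambda>x. (T ^^ l n) x + (- r n * real n / real (l n + 1)) *\<^sub>R
      (real (l n + 1) *\<^sub>R ((T ^^ (l n + 1)) x - (T ^^ (l n + 1 - 1)) x)))" if "n \<ge> 1" for n
  proof
    fix x
    have "G n x = real n *\<^sub>R ((T ^^ l n) x - r n *\<^sub>R (T ^^ (l n + 1)) x)"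
      unfolding G_def f_def using Tk by (simp add: linear_simps funpow_swap1)
    also have "\<dots> = (real n * (1 - r n)) *\<^sub>R (T ^^ l n) x +
        (- r n * real n) *\<^sub>R ((T ^^ (l n + 1)) x - (T ^^ l n) x)"
      by (simp only: scaleR_diff_right scaleR_scaleR scaleR_minus_left scaleR_diff_left mult_minus_left
          right_diff_distrib) (simp add: algebra_simps)
    also have "real n * (1 - r n) = 1" using that by (simp add: r_def)
    finally show "G n x = (T ^^ l n) x + (- r n * real n / real (l n + 1)) *\<^sub>R
        (real (l n + 1) *\<^sub>R ((T ^^ (l n + 1)) x - (T ^^ (l n + 1 - 1)) x))" by simp
  qed
  have G_bd: "R_bd (M0 + (real (m + 1)) * M1) {G n |n. n \<ge> 1}"
  proof (rule R_bd_subset[OF R_bd_add[OF M0 R_bd_scale[OF M1]]])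
    show "{G n |n. n \<ge> 1} \<subseteq> {\<lambda>x. f x + g x |f g. f \<in> ?P \<and>
        g \<in> {\<lambda>x. r *\<^sub>R f x |r f. \<bar>r\<bar> \<le> real (m + 1) \<and> f \<in> ?D}}"
    proof clarify
      fix n :: nat assume n: "n \<ge> 1"
      let ?c = "- r n * real n / real (l n + 1)"
      let ?d = "\<lambda>x. real (l n + 1) *\<^sub>R ((T ^^ (l n + 1)) x - (T ^^ (l n + 1 - 1)) x)"
      have "\<bar>?c\<bar> = r n * (real n / real (l n + 1))" using r[OF n] by (simp add: abs_mult)
      also have "\<dots> \<le> 1 * real (m + 1)"
        using r[OF n] l[of n] by (intro mult_mono) (simp_all add: pos_divide_le_eq)
      finally have "\<bar>?c\<bar> \<le> real (m + 1)" by simp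
      moreover have "?d \<in> ?D" by (rule CollectI, rule exI[of _ "l n + 1"]) simp
      ultimately have "(\<lambda>x. ?c *\<^sub>R ?d x) \<in> {\<lambda>x. r *\<^sub>R f x |r f. \<bar>r\<bar> \<le> real (m + 1) \<and> f \<in> ?D}"
        by (rule scaled_family_memI)
      moreover have "T ^^ l n \<in> ?P" by blast
      ultimately show "\<exists>f g. G n = (\<lambda>x. f x + g x) \<and> f \<in> ?P \<and>
          g \<in> {\<lambda>x. r *\<^sub>R f x |r f. \<bar>r\<bar> \<le> real (m + 1) \<and> f \<in> ?D}"
        using G_eq[OF n]
        by (intro exI[of _ "T ^^ l n"] exI[of _ "\<lambda>x. ?c *\<^sub>R ?d x"] conjI)
    qed
  qed simp
  have G_pow: "(G n ^^ p) x = real n ^ p *\<^sub>R (f n ^^ p) ((T ^^ (l n * p)) x)" for n p x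
  proof (induction p)
    case (Suc p)
    have "(G n ^^ Suc p) x = real n ^ p *\<^sub>R G n ((f n ^^ p) ((T ^^ (l n * p)) x))"
      using G_lin[of n] by (simp add: Suc.IH linear_simps)
    also have "G n ((f n ^^ p) ((T ^^ (l n * p)) x)) =
        real n *\<^sub>R (f n ^^ Suc p) ((T ^^ l n) ((T ^^ (l n * p)) x))"
      unfolding G_def
      using funpow_commute[of "f n" T "Suc p" "l n" "(T ^^ (l n * p)) x", OF fT] by simp
    also have "(T ^^ l n) ((T ^^ (l n * p)) x) = (T ^^ (l n * Suc p)) x"
      by (simp add: funpow_add)
    finally show ?case by simp
  qed simp
  let ?GP = "{g ^^ (m + 1) |g. g \<in> {G n |n. n \<ge> 1}}"
  note bd = R_bd_scale[OF R_bd_comp[OF M2 R_bd_comp[OF R_bd_funpow[OF G_bd, of "m + 1"] M0]], of 1]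
  show ?thesis
  proof (rule that, rule R_bd_subset[OF bd], simp, clarify)
    fix n :: nat assume n: "n \<ge> 1"
    define c where "c = (1 - (r n)\<^sup>2) powr ((1 + \<beta>) / 2)"
    define V where "V x = c *\<^sub>R C ((resolvent_at T (of_real (r n)) ^^ (m + 1)) x)" for x
    define t where "t = (n - 1) mod (m + 1)"
    \<comment> \<open>The composition of \<open>V\<close>, \<open>G n ^^ (m + 1)\<close> and
      \<open>T ^^ t\<close> is c n^(m+1) C T^(n-1), and \<open>e\<close> restores the desired
      weight. From 1 - r^2 \<ge> 1 - r = 1/n comes c \<ge> n^(-(1+\<beta>)/2), and m + 1 -
      (1+\<beta>)/2 = (1+\<alpha>)/2, hence \<open>e \<le> 1\<close>.\<close>
    define e where "e = real n powr ((1 + \<alpha>) / 2) / (c * real n ^ (m + 1))"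
    have V_eq: "V = (\<lambda>x. (1 - (cmod (of_real (r n)))\<^sup>2) powr ((1 + \<beta>) / 2) *\<^sub>R
        C ((resolvent_at T (of_real (r n)) ^^ (m + 1)) x))"
      by (rule ext) (simp only: V_def c_def norm_of_real power2_abs)
    have lt1: "cmod (of_real (r n)) < 1" using r[OF n] by simp
    have V: "V \<in> ?F" using V_eq lt1 by blast
    have "1 / real n \<le> 1 - (r n)\<^sup>2"
    proof -
      have "(r n)\<^sup>2 \<le> r n" using r[OF n] by (simp add: power2_eq_square mult_left_le)
      then show ?thesis by (simp add: r_def)
    qed
    then have "(1 / real n) powr ((1 + \<beta>) / 2) \<le> c"
      unfolding c_def using n \<beta> by (intro powr_mono2) auto
    moreover have pos: "0 < (1 / real n) powr ((1 + \<beta>) / 2)" using n by simp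
    ultimately have "c > 0" by linarith
    have "e \<ge> 0" using \<open>c > 0\<close> by (simp add: e_def)
    have "real n powr ((1 + \<alpha>) / 2) = (1 / real n) powr ((1 + \<beta>) / 2) * real n ^ (m + 1)"
    proof -
      have "(1 / real n) powr ((1 + \<beta>) / 2) * real n ^ (m + 1) =
          real n powr (- ((1 + \<beta>) / 2)) * real n powr (real (m + 1))"
        using n by (simp add: powr_minus_divide powr_divide powr_realpow del: of_nat_Suc)
      also have "\<dots> = real n powr ((1 + \<alpha>) / 2)"
        unfolding powr_add[symmetric] using m by (intro arg_cong[where f="(powr) (real n)"]) (simp add: field_simps)
      finally show ?thesis by simp
    qed
    also have "\<dots> \<le> c * real n ^ (m + 1)"
      using \<open>(1 / real n) powr ((1 + \<beta>) / 2) \<le> c\<close> by (intro mult_right_mono) auto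
    finally have "e \<le> 1" unfolding e_def using \<open>c > 0\<close> n by (simp add: divide_le_eq_1)
    have res: "resolvent_at T (of_real (r n)) (f n x) = x" for x
      unfolding f_def using R_bd_norm_le[OF M0] r[OF n]
      by (intro resolvent_at_left_inverse[OF T, of M0]) auto
    have key: "V ((G n ^^ (m + 1)) ((T ^^ t) x)) = (c * real n ^ (m + 1)) *\<^sub>R C ((T ^^ (n - 1)) x)" for x
    proof -
      have Vlin: "bounded_linear V" unfolding V_eq using lt1 by (rule lin)
      have "(T ^^ (l n * (m + 1))) ((T ^^ t) x) = (T ^^ (l n * (m + 1) + t)) x"
        by (simp only: funpow_add comp_def)
      also have "l n * (m + 1) + t = n - 1" unfolding l_def t_def by (rule div_mult_mod_eq)
      finally have "(G n ^^ (m + 1)) ((T ^^ t) x) = real n ^ (m + 1) *\<^sub>R (f n ^^ (m + 1)) ((T ^^ (n - 1)) x)"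
        unfolding G_pow by simp
      then have "V ((G n ^^ (m + 1)) ((T ^^ t) x)) =
          real n ^ (m + 1) *\<^sub>R V ((f n ^^ (m + 1)) ((T ^^ (n - 1)) x))"
        using Vlin by (simp only: linear_simps)
      also have "V ((f n ^^ (m + 1)) ((T ^^ (n - 1)) x)) = c *\<^sub>R C ((T ^^ (n - 1)) x)"
        unfolding V_def by (simp only: funpow_left_inverse[of "resolvent_at T (of_real (r n))" "f n", OF res])
      finally show ?thesis by (simp add: mult.commute)
    qed
    have "(\<lambda>x. real n powr ((1 + \<alpha>) / 2) *\<^sub>R C ((T ^^ (n - 1)) x)) =
        (\<lambda>x. e *\<^sub>R (V \<circ> ((G n ^^ (m + 1)) \<circ> (T ^^ t))) x)"
    proof
      fix x
      have "e * (c * real n ^ (m + 1)) = real n powr ((1 + \<alpha>) / 2)"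
        unfolding e_def using \<open>c > 0\<close> n by simp
      then show "real n powr ((1 + \<alpha>) / 2) *\<^sub>R C ((T ^^ (n - 1)) x) =
          e *\<^sub>R (V \<circ> ((G n ^^ (m + 1)) \<circ> (T ^^ t))) x"
        by (simp only: comp_apply key scaleR_scaleR)
    qed
    moreover have "V \<circ> ((G n ^^ (m + 1)) \<circ> (T ^^ t)) \<in>
        {f \<circ> g |f g. f \<in> ?F \<and> g \<in> {f \<circ> g |f g. f \<in> ?GP \<and> g \<in> ?P}}"
      using V n by blast
    moreover have "\<bar>e\<bar> \<le> 1" using \<open>e \<ge> 0\<close> \<open>e \<le> 1\<close> by simp
    ultimately show "\<exists>r' f'. (\<lambda>x. real n powr ((1 + \<alpha>) / 2) *\<^sub>R C ((T ^^ (n - 1)) x)) = (\<lambda>x. r' *\<^sub>R f' x) \<and>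
        \<bar>r'\<bar> \<le> 1 \<and> f' \<in> {f \<circ> g |f g. f \<in> ?F \<and> g \<in> {f \<circ> g |f g. f \<in> ?GP \<and> g \<in> ?P}}"
      by (intro exI[of _ e] exI[of _ "V \<circ> ((G n ^^ (m + 1)) \<circ> (T ^^ t))"] conjI)
  qed
qed

text \<open>Each summand has weight 1/a and belongs to the index n = l + a - b + 1 \<ge> a/2, so
  replacing n by a in the weight costs at most 2^((1+\<alpha>)/2), and convexity applies. These
  means arise when T^(a-1) - T^(2a-1) is cut into a increments and T^b - T^(b-1) is split off from
  each.\<close>

lemma R_bd_observed_means:
  fixes T :: "'a::complex_banach \<Rightarrow> 'a" and C :: "'a \<Rightarrow> 'b::complex_banach"
  assumes M: "R_bd M {\<lambda>x. real n powr ((1 + \<alpha>) / 2) *\<^sub>R C ((T ^^ (n - 1)) x) |n. n \<ge> 1}"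
    (is "R_bd M ?W")
    and \<alpha>: "\<alpha> > -1"
  shows "R_bd (2 powr ((1 + \<alpha>) / 2) * M)
    {\<lambda>x. \<Sum>l<a. (real a powr ((1 + \<alpha>) / 2) / real a) *\<^sub>R C ((T ^^ (l + a - b)) x) |a b. 1 \<le> b \<and> 2 * b \<le> a}"
proof (rule R_bd_subset[OF R_bd_convex[OF R_bd_scale[OF M]]])
  let ?g = "(1 + \<alpha>) / 2"
  let ?F = "{\<lambda>x. r *\<^sub>R f x |r f. \<bar>r\<bar> \<le> 2 powr ?g \<and> f \<in> ?W}"
  show "{\<lambda>x. \<Sum>l<a. (real a powr ?g / real a) *\<^sub>R C ((T ^^ (l + a - b)) x) |a b. 1 \<le> b \<and> 2 * b \<le> a}
    \<subseteq> {\<lambda>x. \<Sum>l\<in>L. c l *\<^sub>R f l x |(L::nat set) c f. (\<forall>l\<in>L. 0 \<le> c l \<and> f l \<in> ?F) \<and> (\<Sum>l\<in>L. c l) = 1}"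
  proof clarify
    fix a b :: nat assume ab: "1 \<le> b" "2 * b \<le> a"
    define f where "f l = (\<lambda>x. real a powr ?g *\<^sub>R C ((T ^^ (l + a - b)) x))" for l
    have "f l \<in> ?F" for l
    proof -
      define n where "n = l + a - b + 1"
      have n: "n \<ge> 1" "n - 1 = l + a - b" "real a \<le> 2 * real n" unfolding n_def using ab by auto
      let ?r = "real a powr ?g / real n powr ?g"
      have "real a powr ?g \<le> (2 * real n) powr ?g" using n(3) \<alpha> by (intro powr_mono2) auto
      also have "\<dots> = 2 powr ?g * real n powr ?g" by (simp add: powr_mult)
      finally have "\<bar>?r\<bar> \<le> 2 powr ?g" using n(1) by (simp add: pos_divide_le_eq)
      moreover have "(\<lambda>x. real n powr ?g *\<^sub>R C ((T ^^ (n - 1)) x)) \<in> ?W" using n(1) by blast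
      ultimately have "(\<lambda>x. ?r *\<^sub>R (real n powr ?g *\<^sub>R C ((T ^^ (n - 1)) x))) \<in> ?F"
        by (rule scaled_family_memI)
      moreover have "f l = (\<lambda>x. ?r *\<^sub>R (real n powr ?g *\<^sub>R C ((T ^^ (n - 1)) x)))"
        unfolding f_def n(2) using n(1) by simp
      ultimately show ?thesis by (simp only:)
    qed
    moreover have "(\<lambda>x. \<Sum>l<a. (real a powr ?g / real a) *\<^sub>R C ((T ^^ (l + a - b)) x)) =
        (\<lambda>x. \<Sum>l<a. (1 / real a) *\<^sub>R f l x)"
      unfolding f_def by simp
    moreover have "(\<Sum>l<a. 1 / real a) = 1" using ab by simp
    ultimately show "\<exists>(L::nat set) c f'. (\<lambda>x. \<Sum>l<a. (real a powr ?g / real a) *\<^sub>R C ((T ^^ (l + a - b)) x)) =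
        (\<lambda>x. \<Sum>l\<in>L. c l *\<^sub>R f' l x) \<and> (\<forall>l\<in>L. 0 \<le> c l \<and> f' l \<in> ?F) \<and> (\<Sum>l\<in>L. c l) = 1"
      by (intro exI[of _ "{..<a}"] exI[of _ "\<lambda>_. 1 / real a"] exI[of _ f]) simp
  qed
qed simp

section \<open>Dyadic decomposition of the orbit\<close>

text \<open>The contribution of one scale N, a power of 2 in the application. A single residue class
  mod 4 leaves room for disjoint blocks within b \<le> a/2, and starting \<open>K\<close> at 4p
  keeps the blocks in \<open>{p..}\<close>, so that \<open>B\<close> can be a tail bound of the
  square function.\<close>

lemma rad_norm_dyadic_piece:
  fixes T :: "'a::complex_banach \<Rightarrow> 'a" and C :: "'a \<Rightarrow> 'b::complex_banach" and N p s :: nat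
  defines "z \<equiv> \<lambda>x j. real j powr (1 / 2) *\<^sub>R ((T ^^ j) x - (T ^^ (j - 1)) x)"
  assumes T: "bounded_linear T" and C: "bounded_linear C"
    and M: "R_bd M {\<lambda>x. \<Sum>l<a. (real a powr ((1 + \<alpha>) / 2) / real a) *\<^sub>R C ((T ^^ (l + a - b)) x) |a b.
      1 \<le> b \<and> 2 * b \<le> a}" (is "R_bd M ?F")
    and N: "N \<ge> 1" and p: "p \<ge> 1"
    and K: "finite K" "K \<subseteq> {4 * p..}" "\<And>k. k \<in> K \<Longrightarrow> k mod 4 = s"
    and bound: "\<And>J. finite J \<Longrightarrow> J \<subseteq> {p..} \<Longrightarrow> rad_norm J (z x) \<le> B"
  shows "rad_norm K (\<lambda>k. real k powr (\<alpha> / 2) *\<^sub>R (C ((T ^^ (N * k - 1)) x) - C ((T ^^ (2 * N * k - 1)) x)))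
    \<le> sqrt 24 * M * real N powr (- ((1 + \<alpha>) / 2)) * B"
proof -
  define d where "d k = real k powr (\<alpha> / 2) *\<^sub>R (C ((T ^^ (N * k - 1)) x) - C ((T ^^ (2 * N * k - 1)) x))" for k
  \<comment> \<open>Recovers k from an index of its block. Blocks start at N (k div 4) + 1, hence
    the shift by 1; within one residue class \<open>k div 4\<close> determines k, so blocks are
    disjoint.\<close>
  define g where "g j = 4 * ((j - 1) div N) + s" for j
  define J where "J = (\<Union>k\<in>K. {N * (k div 4) + 1..N * (k div 4) + N})"
  define S where "S a b x = (\<Sum>l<a. (real a powr ((1 + \<alpha>) / 2) / real a) *\<^sub>R C ((T ^^ (l + a - b)) x))" for a b x
  have g_block: "g j = k" if "k \<in> K" "j \<in> {N * (k div 4) + 1..N * (k div 4) + N}" for j k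
  proof -
    have "(j - 1) div N = k div 4"
      using that(2) N by (intro div_nat_eqI) (auto simp: mult.commute)
    then show ?thesis using K(3)[OF that(1)] mult_div_mod_eq[of 4 k] by (simp add: g_def)
  qed
  have J_fin: "finite J" unfolding J_def using K(1) by simp
  have gJ: "g ` J \<subseteq> K" unfolding J_def using g_block by fastforce
  have block: "{j\<in>J. g j = k} = {N * (k div 4) + 1..N * (k div 4) + N}" if "k \<in> K" for k
  proof
    show "{N * (k div 4) + 1..N * (k div 4) + N} \<subseteq> {j\<in>J. g j = k}"
      using that g_block[OF that] unfolding J_def by blast
    show "{j\<in>J. g j = k} \<subseteq> {N * (k div 4) + 1..N * (k div 4) + N}"
    proof
      fix j assume j: "j \<in> {j\<in>J. g j = k}"
      then obtain k' where k': "k' \<in> K" "j \<in> {N * (k' div 4) + 1..N * (k' div 4) + N}"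
        unfolding J_def by blast
      then have "k' = k" using g_block[OF k'] j by simp
      then show "j \<in> {N * (k div 4) + 1..N * (k div 4) + N}" using k' by simp
    qed
  qed
  have k_ge: "4 * p \<le> k" if "k \<in> K" for k using K(2) that by auto
  \<comment> \<open>With q = k div 4 \<ge> 1: j \<le> N (q + 1) \<le> 2 N q \<le> N k / 2, and N k
    \<le> N (4 q + 3) \<le> 8 N q < 8 j.\<close>
  have sizes: "p \<le> j \<and> 1 \<le> j \<and> 2 * j \<le> N * k \<and> N * k \<le> 8 * j"
    if "k \<in> K" "j \<in> {N * (k div 4) + 1..N * (k div 4) + N}" for j k
  proof -
    define q where "q = k div 4"
    have q: "p \<le> q" "4 * q \<le> k" "k \<le> 4 * q + 3" using k_ge[OF that(1)] unfolding q_def by linarith+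
    have q1: "1 \<le> q" using p q(1) by linarith
    have j: "N * q + 1 \<le> j" "j \<le> N * q + N" using that(2) unfolding q_def by auto
    have "N \<le> N * q" using q1 by simp
    have "q \<le> N * q" using N by simp
    moreover have "4 * (N * q) \<le> N * k" using mult_le_mono2[OF q(2), of N] by (simp add: mult_ac)
    moreover have "N * k \<le> 8 * (N * q)"
    proof -
      have "k \<le> 8 * q" using q(3) q1 by linarith
      from mult_le_mono2[OF this, of N] show ?thesis by (simp add: mult_ac)
    qed
    ultimately show ?thesis using j q(1) q1 \<open>N \<le> N * q\<close> by (intro conjI) linarith+
  qed
  \<comment> \<open>There are exactly a increments T^(a+l) - T^(a-1+l) with l < a, each equal to
    T^(l+a-b) (T^b - T^(b-1)). The condition b \<le> a/2 leaves a power of at least a/2 next to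
    \<open>C\<close>. The minus sign reflects that the increments go forward.\<close>
  have S_eq: "C ((T ^^ (a - 1)) x) - C ((T ^^ (2 * a - 1)) x) =
      (- (real a powr (1 - (1 + \<alpha>) / 2) * real b powr (- 1 / 2))) *\<^sub>R S a b (z x b)"
    if ab: "1 \<le> b" "2 * b \<le> a" for a b
  proof -
    have Tk: "bounded_linear (T ^^ k)" for k using T by (rule bounded_linear_funpow)
    have a1: "a \<ge> 1" using ab by simp
    have "C ((T ^^ (2 * a - 1)) x) - C ((T ^^ (a - 1)) x) =
        (\<Sum>l<a. C ((T ^^ (a - 1 + Suc l)) x) - C ((T ^^ (a - 1 + l)) x))"
      using a1 by (subst sum_lessThan_telescope[of "\<lambda>l. C ((T ^^ (a - 1 + l)) x)"])
        (simp add: mult_2)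
    also have "\<dots> = (\<Sum>l<a. C ((T ^^ (l + a - b)) ((T ^^ b) x - (T ^^ (b - 1)) x)))"
    proof (rule sum.cong[OF refl])
      fix l
      have "l + a - b + b = a - 1 + Suc l" "l + a - b + (b - 1) = a - 1 + l" using ab by auto
      then have "(T ^^ (l + a - b)) ((T ^^ b) x) = (T ^^ (a - 1 + Suc l)) x"
        "(T ^^ (l + a - b)) ((T ^^ (b - 1)) x) = (T ^^ (a - 1 + l)) x"
        by (metis comp_apply funpow_add)+
      then show "C ((T ^^ (a - 1 + Suc l)) x) - C ((T ^^ (a - 1 + l)) x) =
          C ((T ^^ (l + a - b)) ((T ^^ b) x - (T ^^ (b - 1)) x))"
        using Tk C by (simp only: linear_simps)
    qed
    also have "\<dots> = (real a powr (1 - (1 + \<alpha>) / 2) * real b powr (- 1 / 2)) *\<^sub>R S a b (z x b)"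
    proof -
      have b: "real b powr (- 1 / 2) * real b powr (1 / 2) = 1"
        using ab by (simp add: powr_add[symmetric])
      have a: "real a powr (1 - (1 + \<alpha>) / 2) * (real a powr ((1 + \<alpha>) / 2) / real a) = 1"
        using a1 by (simp add: powr_add[symmetric])
      have e: "real a powr (1 - (1 + \<alpha>) / 2) * real b powr (- 1 / 2) *
          (real a powr ((1 + \<alpha>) / 2) / real a * real b powr (1 / 2)) = 1"
        using arg_cong2[OF a b, of "(*)"] by (simp only: mult.commute mult.left_commute mult.assoc mult_1)
      have "S a b (z x b) = (\<Sum>l<a. (real a powr ((1 + \<alpha>) / 2) / real a * real b powr (1 / 2)) *\<^sub>R
          C ((T ^^ (l + a - b)) ((T ^^ b) x - (T ^^ (b - 1)) x)))"
        unfolding S_def z_def using Tk C by (simp add: linear_simps)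
      then show ?thesis
        by (simp only: scaleR_sum_right scaleR_scaleR e scaleR_one)
    qed
    finally show ?thesis by (metis minus_diff_eq scaleR_minus_left)
  qed
  let ?\<rho> = "\<lambda>j. - (real (g j) powr (\<alpha> / 2) * (real (N * g j) powr (1 - (1 + \<alpha>) / 2) * real j powr (- 1 / 2)))"
  have J1: "J \<subseteq> {1..}" and Jp: "J \<subseteq> {p..}" unfolding J_def using sizes by force+
  have J_sizes: "g j \<in> K \<and> 1 \<le> j \<and> 2 * j \<le> N * g j \<and> N * g j \<le> 8 * j" if "j \<in> J" for j
    using that g_block sizes unfolding J_def by fastforce
  \<comment> \<open>With k = g j, the modulus of the coefficient is k^(\<alpha>/2) (N
    k)^((1-\<alpha>)/2) j^(-1/2) = N^(-\<alpha>/2) (N k / j)^(1/2), and N k \<le> 8 j.\<close>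
  let ?c = "sqrt 8 * real N powr (- \<alpha> / 2)"
  \<comment> \<open>The vector \<open>d k\<close> is the same at all indices of its block, yet at
    each index j it is expressed through the increment with b = j. This is how the square function
    over all of \<open>J\<close> enters.\<close>
  have "rad_norm J (\<lambda>j. d (g j)) = rad_norm J (\<lambda>j. ?\<rho> j *\<^sub>R S (N * g j) j (z x j))"
  proof (rule rad_norm_cong)
    fix j assume "j \<in> J"
    then have "1 \<le> j" "2 * j \<le> N * g j" using J_sizes by blast+
    from S_eq[OF this] show "d (g j) = ?\<rho> j *\<^sub>R S (N * g j) j (z x j)"
      unfolding d_def by (simp add: mult.assoc)
  qed
  also have "\<dots> \<le> (?c * M) * rad_norm J (z x)"
  proof (rule R_bdD[OF R_bd_scale[OF M] J_fin J1])
    fix j assume "j \<in> J"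
    note j = J_sizes[OF this]
    have "g j > 0" using k_ge[of "g j"] j p by auto
    have "\<bar>?\<rho> j\<bar> = real (g j) powr (\<alpha> / 2) * (real (N * g j) powr (1 / 2 - \<alpha> / 2) * real j powr (- 1 / 2))"
      by (simp add: abs_mult field_simps)
    also have "real (N * g j) powr (1 / 2 - \<alpha> / 2) = real (N * g j) powr (1 / 2) * (real N powr (- \<alpha> / 2) * real (g j) powr (- \<alpha> / 2))"
      using \<open>g j > 0\<close> N by (simp add: powr_add[symmetric] powr_mult[symmetric])
    also have "real (g j) powr (\<alpha> / 2) * (real (N * g j) powr (1 / 2) * (real N powr (- \<alpha> / 2) * real (g j) powr (- \<alpha> / 2)) * real j powr (- 1 / 2))
      = (real (g j) powr (\<alpha> / 2) * real (g j) powr (- \<alpha> / 2)) * (real (N * g j) powr (1 / 2) * real j powr (- 1 / 2)) * real N powr (- \<alpha> / 2)"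
      by (simp only: ac_simps)
    also have "real (g j) powr (\<alpha> / 2) * real (g j) powr (- \<alpha> / 2) = 1"
      using \<open>g j > 0\<close> by (simp add: powr_add[symmetric])
    also have "1 * (real (N * g j) powr (1 / 2) * real j powr (- 1 / 2)) * real N powr (- \<alpha> / 2) \<le> sqrt 8 * real N powr (- \<alpha> / 2)"
    proof (rule mult_right_mono)
      have "real (N * g j) \<le> 8 * real j" using j by linarith
      then have "real (N * g j) powr (1 / 2) \<le> sqrt 8 * real j powr (1 / 2)"
        by (simp add: powr_half_sqrt real_sqrt_mult[symmetric])
      then have "real (N * g j) powr (1 / 2) * real j powr (- 1 / 2) \<le> sqrt 8 * real j powr (1 / 2) * real j powr (- 1 / 2)"
        by (rule mult_right_mono) simp
      also have "\<dots> = sqrt 8" using j by (simp add: mult.assoc powr_add[symmetric])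
      finally show "1 * (real (N * g j) powr (1 / 2) * real j powr (- 1 / 2)) \<le> sqrt 8" by simp
    qed simp
    finally have "\<bar>?\<rho> j\<bar> \<le> ?c" .
    moreover have "S (N * g j) j \<in> ?F"
      by (rule CollectI, rule exI[of _ "N * g j"], rule exI[of _ j]) (use j in \<open>auto simp: S_def\<close>)
    ultimately show "(\<lambda>y. ?\<rho> j *\<^sub>R S (N * g j) j y) \<in> {\<lambda>x. r *\<^sub>R f x |r f. \<bar>r\<bar> \<le> ?c \<and> f \<in> ?F}"
      by (rule scaled_family_memI)
  qed simp
  also have "\<dots> \<le> (?c * M) * B"
    using R_bd_nonneg[OF M] by (intro mult_left_mono bound J_fin Jp) auto
  finally have le: "rad_norm J (\<lambda>j. d (g j)) \<le> (?c * M) * B" .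
  \<comment> \<open>The factor sqrt (3 / N) turns N^(-\<alpha>/2) into N^(-(1+\<alpha>)/2), and sqrt
    8 into sqrt 24.\<close>
  have "rad_norm K d \<le> sqrt (3 / real N) * rad_norm J (\<lambda>j. d (g j))"
  proof (rule rad_norm_blocks[OF K(1) _ J_fin gJ])
    show "K \<subseteq> {1..}" using k_ge p by fastforce
    show "card {j\<in>J. g j = k} = N" if "k \<in> K" for k using block[OF that] by simp
  qed (use N in simp)
  also have "\<dots> \<le> sqrt (3 / real N) * ((?c * M) * B)"
    by (intro mult_left_mono le) simp
  also have "\<dots> = (sqrt 3 * sqrt 8) * M * (real N powr (- \<alpha> / 2) / sqrt (real N)) * B"
    by (simp add: real_sqrt_divide)
  also have "sqrt 3 * sqrt 8 = sqrt 24" by (simp add: real_sqrt_mult[symmetric])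
  also have "real N powr (- \<alpha> / 2) / sqrt (real N) = real N powr (- ((1 + \<alpha>) / 2))"
  proof -
    have "real N powr (- \<alpha> / 2) / sqrt (real N) = real N powr (- \<alpha> / 2 - 1 / 2)"
      by (simp add: powr_half_sqrt[symmetric] powr_diff)
    also have "- \<alpha> / 2 - 1 / 2 = - ((1 + \<alpha>) / 2)" by (simp add: field_simps)
    finally show ?thesis .
  qed
  finally show ?thesis unfolding d_def .
qed

text \<open>The scales N = 2^i form a geometric series with ratio \<theta> = 2^(-(1+\<alpha>)/2),
  which is below 1 because \<alpha> > -1. The factor 4 counts residue classes.\<close>

lemma rad_norm_observed_tail:
  fixes T :: "'a::complex_banach \<Rightarrow> 'a" and C :: "'a \<Rightarrow> 'b::complex_banach" and p :: nat
  defines "z \<equiv> \<lambda>x j. real j powr (1 / 2) *\<^sub>R ((T ^^ j) x - (T ^^ (j - 1)) x)"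
  assumes T: "bounded_linear T" and C: "bounded_linear C" and \<alpha>: "\<alpha> > -1"
    and M: "R_bd M {\<lambda>x. real n powr ((1 + \<alpha>) / 2) *\<^sub>R C ((T ^^ (n - 1)) x) |n. n \<ge> 1}" (is "R_bd M ?W")
    and p: "p \<ge> 1" and K: "finite K" "K \<subseteq> {4 * p..}"
    and bound: "\<And>J. finite J \<Longrightarrow> J \<subseteq> {p..} \<Longrightarrow> rad_norm J (z x) \<le> B"
  shows "rad_norm K (\<lambda>k. real k powr (\<alpha> / 2) *\<^sub>R C ((T ^^ (k - 1)) x)) \<le>
    4 * sqrt 24 * (2 powr ((1 + \<alpha>) / 2) * M) / (1 - 2 powr (- ((1 + \<alpha>) / 2))) * B"
proof -
  let ?g = "(1 + \<alpha>) / 2"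
  define \<theta> where "\<theta> = 2 powr (- ?g)"
  define M' where "M' = 2 powr ?g * M"
  have \<theta>: "0 < \<theta>" "\<theta> < 1"
    using \<alpha> powr_less_mono[of "- ?g" 0 2] by (simp_all add: \<theta>_def)
  have M': "R_bd M' {\<lambda>x. \<Sum>l<a. (real a powr ?g / real a) *\<^sub>R C ((T ^^ (l + a - b)) x) |a b.
      1 \<le> b \<and> 2 * b \<le> a}"
    unfolding M'_def using M \<alpha> by (rule R_bd_observed_means)
  have "B \<ge> 0" by (rule order_trans[OF rad_norm_nonneg bound[of "{}"]]) simp_all
  have pow: "real (2 ^ i) powr (- ?g) = \<theta> ^ i" for i
    unfolding \<theta>_def by (simp add: powr_power powr_realpow[symmetric] powr_powr mult.commute)
  define d where "d i k = real k powr (\<alpha> / 2) *\<^sub>R (C ((T ^^ (2 ^ i * k - 1)) x) - C ((T ^^ (2 * 2 ^ i * k - 1)) x))" for i k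
  have piece: "rad_norm K (d i) \<le> 4 * (sqrt 24 * M' * B) * \<theta> ^ i" for i
  proof -
    have "rad_norm K (d i) \<le> (\<Sum>s<4. rad_norm {k\<in>K. k mod 4 = s} (d i))"
      by (rule rad_norm_split[OF K(1)]) simp
    also have "\<dots> \<le> (\<Sum>s<4::nat. sqrt 24 * M' * real (2 ^ i) powr (- ?g) * B)"
      unfolding d_def
    proof (rule sum_mono, rule rad_norm_dyadic_piece[OF T C M' _ p])
      fix s J
      show "finite J \<Longrightarrow> J \<subseteq> {p..} \<Longrightarrow>
          rad_norm J (\<lambda>j. real j powr (1 / 2) *\<^sub>R ((T ^^ j) x - (T ^^ (j - 1)) x)) \<le> B"
        using bound[of J] unfolding z_def .
    qed (use K in auto)
    also have "\<dots> = 4 * (sqrt 24 * M' * B) * \<theta> ^ i" unfolding pow by simp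
    finally show ?thesis .
  qed
  let ?a = "\<lambda>k. real k powr (\<alpha> / 2) *\<^sub>R C ((T ^^ (k - 1)) x)"
  let ?c = "4 * (sqrt 24 * M' * B)"
  \<comment> \<open>Termwise bound of the remainder left after \<open>I\<close> doublings. It
    depends on \<open>K\<close>, but is multiplied by \<theta>^I, and \<open>I\<close> tends to
    infinity with \<open>K\<close> fixed.\<close>
  let ?R = "\<Sum>k\<in>K. real k powr (\<alpha> / 2) * (real k powr (- ?g) * (M * norm x))"
  have step: "rad_norm K ?a \<le> ?c / (1 - \<theta>) + \<theta> ^ I * ?R" for I
  proof -
    have "rad_norm K ?a = rad_norm K (\<lambda>k. (\<Sum>i<I. d i k) + real k powr (\<alpha> / 2) *\<^sub>R C ((T ^^ (2 ^ I * k - 1)) x))"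
    proof (rule rad_norm_cong)
      fix k
      have "(\<Sum>i<I. C ((T ^^ (2 ^ i * k - 1)) x) - C ((T ^^ (2 ^ Suc i * k - 1)) x)) =
          C ((T ^^ (2 ^ 0 * k - 1)) x) - C ((T ^^ (2 ^ I * k - 1)) x)"
        by (rule sum_lessThan_telescope')
      then have "(\<Sum>i<I. d i k) = real k powr (\<alpha> / 2) *\<^sub>R (C ((T ^^ (k - 1)) x) - C ((T ^^ (2 ^ I * k - 1)) x))"
        unfolding d_def scaleR_sum_right[symmetric] by simp
      then show "?a k = (\<Sum>i<I. d i k) + real k powr (\<alpha> / 2) *\<^sub>R C ((T ^^ (2 ^ I * k - 1)) x)"
        by (simp add: scaleR_diff_right)
    qed
    also have "\<dots> \<le> rad_norm K (\<lambda>k. \<Sum>i<I. d i k) + rad_norm K (\<lambda>k. real k powr (\<alpha> / 2) *\<^sub>R C ((T ^^ (2 ^ I * k - 1)) x))"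
      by (rule rad_norm_add)
    also have "rad_norm K (\<lambda>k. \<Sum>i<I. d i k) \<le> (\<Sum>i<I. rad_norm K (d i))"
      by (rule rad_norm_sum)
    also have "\<dots> \<le> (\<Sum>i<I. ?c * \<theta> ^ i)" by (intro sum_mono piece)
    also have "\<dots> = ?c * (\<Sum>i<I. \<theta> ^ i)" by (rule sum_distrib_left[symmetric])
    also have "\<dots> \<le> ?c * (1 / (1 - \<theta>))"
    proof (rule mult_left_mono)
      have "(\<Sum>i<I. \<theta> ^ i) = (1 - \<theta> ^ I) / (1 - \<theta>)" using \<theta> by (simp add: sum_gp_strict)
      also have "\<dots> \<le> 1 / (1 - \<theta>)" using \<theta> by (intro divide_right_mono) auto
      finally show "(\<Sum>i<I. \<theta> ^ i) \<le> 1 / (1 - \<theta>)" .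
      show "0 \<le> ?c" using \<open>B \<ge> 0\<close> R_bd_nonneg[OF M'] by simp
    qed
    also have "rad_norm K (\<lambda>k. real k powr (\<alpha> / 2) *\<^sub>R C ((T ^^ (2 ^ I * k - 1)) x)) \<le>
        (\<Sum>k\<in>K. norm (real k powr (\<alpha> / 2) *\<^sub>R C ((T ^^ (2 ^ I * k - 1)) x)))"
      by (rule rad_norm_le_sum[OF K(1)])
    also have "\<dots> \<le> (\<Sum>k\<in>K. \<theta> ^ I * (real k powr (\<alpha> / 2) * (real k powr (- ?g) * (M * norm x))))"
    proof (rule sum_mono)
      fix k assume "k \<in> K"
      then have k: "k \<ge> 1" using K(2) p by auto
      define n where "n = 2 ^ I * k"
      have n: "n \<ge> 1" unfolding n_def using k by simp
      have "(\<lambda>x. real n powr ?g *\<^sub>R C ((T ^^ (n - 1)) x)) \<in> ?W" using n by blast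
      from R_bd_norm_le[OF M this, of x]
      have "real n powr ?g * norm (C ((T ^^ (n - 1)) x)) \<le> M * norm x" by simp
      then have "real n powr (- ?g) * (real n powr ?g * norm (C ((T ^^ (n - 1)) x))) \<le> real n powr (- ?g) * (M * norm x)"
        by (rule mult_left_mono) simp
      moreover have "real n powr (- ?g) * real n powr ?g = 1" using n by (simp add: powr_add[symmetric])
      ultimately have "norm (C ((T ^^ (n - 1)) x)) \<le> real n powr (- ?g) * (M * norm x)"
        by (simp only: mult.assoc[symmetric] mult_1)
      also have "real n powr (- ?g) = \<theta> ^ I * real k powr (- ?g)"
        unfolding n_def pow[symmetric] of_nat_mult by (rule powr_mult)
      finally have "real k powr (\<alpha> / 2) * norm (C ((T ^^ (n - 1)) x)) \<le>
          real k powr (\<alpha> / 2) * (\<theta> ^ I * real k powr (- ?g) * (M * norm x))"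
        by (rule mult_left_mono) simp
      then show "norm (real k powr (\<alpha> / 2) *\<^sub>R C ((T ^^ (2 ^ I * k - 1)) x)) \<le>
          \<theta> ^ I * (real k powr (\<alpha> / 2) * (real k powr (- ?g) * (M * norm x)))"
        unfolding n_def by (simp add: mult_ac)
    qed
    also have "\<dots> = \<theta> ^ I * ?R" by (rule sum_distrib_left[symmetric])
    finally show ?thesis by simp
  qed
  have "rad_norm K ?a \<le> ?c / (1 - \<theta>) + 0 * ?R"
  proof (rule LIMSEQ_le_const)
    show "(\<lambda>I. ?c / (1 - \<theta>) + \<theta> ^ I * ?R) \<longlonglongrightarrow> ?c / (1 - \<theta>) + 0 * ?R"
      using \<theta> by (intro tendsto_intros LIMSEQ_realpow_zero) auto
    show "\<exists>N. \<forall>I\<ge>N. rad_norm K ?a \<le> ?c / (1 - \<theta>) + \<theta> ^ I * ?R" using step by blast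
  qed
  also have "?c / (1 - \<theta>) + 0 * ?R = 4 * sqrt 24 * M' / (1 - \<theta>) * B" by simp
  finally show ?thesis unfolding M'_def \<theta>_def .
qed

section \<open>Convergence and norm bound of the observed series\<close>

theorem theorem4p3:
  fixes P :: "'m measure" and \<epsilon> :: "nat \<Rightarrow> 'm \<Rightarrow> real"
    and T :: "'a::complex_banach \<Rightarrow> 'a" and C :: "'a \<Rightarrow> 'b::complex_banach"
    and \<alpha> \<beta> :: real and m :: nat
  assumes "rademacher_sequence P \<epsilon>"
    and "reflexive_space TYPE('a)"
    and "finite_cotype P \<epsilon> TYPE('a)"
    and "R_Ritt P \<epsilon> T"
    and "R_square_function_estimate P \<epsilon> T"
    and "\<alpha> > -1" and "-1 < \<beta>" and "\<beta> < 3"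
    and "real m = (\<alpha> + \<beta>) / 2"
    and "bounded_clinear C"
    and "R_bounded P \<epsilon>
      {\<lambda>x. (1 - (cmod \<omega>)\<^sup>2) powr ((1 + \<beta>) / 2) *\<^sub>R C ((resolvent_at T \<omega> ^^ (m + 1)) x)
        |\<omega>. cmod \<omega> < 1}"
  shows "R_admissible P \<epsilon> \<alpha> C T"
proof -
  note rs = assms(1)
  have T: "bounded_linear T" and C: "bounded_linear C"
    using assms(4,10) by (auto simp: R_Ritt_def bounded_clinear_def)
  have Ritt: "R_bounded P \<epsilon> {T ^^ k |k. k \<ge> 0}"
    "R_bounded P \<epsilon> {\<lambda>x. real k *\<^sub>R ((T ^^ k) x - (T ^^ (k - 1)) x) |k. k \<ge> 1}"
    using assms(4)[unfolded R_Ritt_def] by (simp_all only: simp_thms)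
  obtain M0 where M0: "R_bd M0 {T ^^ k |k. k \<ge> 0}"
    by (rule R_bounded_imp_R_bd[OF rs Ritt(1)])
  obtain M1 where M1: "R_bd M1 {\<lambda>x. real k *\<^sub>R ((T ^^ k) x - (T ^^ (k - 1)) x) |k. k \<ge> 1}"
    by (rule R_bounded_imp_R_bd[OF rs Ritt(2)])
  obtain M2 where M2: "R_bd M2
      {\<lambda>x. (1 - (cmod \<omega>)\<^sup>2) powr ((1 + \<beta>) / 2) *\<^sub>R C ((resolvent_at T \<omega> ^^ (m + 1)) x)
        |\<omega>. cmod \<omega> < 1}"
    by (rule R_bounded_imp_R_bd[OF rs assms(11)])
  have lin: "bounded_linear (\<lambda>x. (1 - (cmod \<omega>)\<^sup>2) powr ((1 + \<beta>) / 2) *\<^sub>R C ((resolvent_at T \<omega> ^^ (m + 1)) x))"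
    (is "bounded_linear ?V") if "cmod \<omega> < 1" for \<omega>
  proof -
    have "bounded_clinear ?V"
      using assms(11)[unfolded R_bounded_def, THEN conjunct1]
      by (rule bspec) (use that in blast)
    then show ?thesis by (simp only: bounded_clinear_def)
  qed
  obtain M where M: "R_bd M {\<lambda>x. real n powr ((1 + \<alpha>) / 2) *\<^sub>R C ((T ^^ (n - 1)) x) |n. n \<ge> 1}"
    by (rule R_bd_observed_powers[OF T M0 M1 C assms(7,9) M2 lin])
  obtain \<kappa> where \<kappa>: "\<kappa> \<ge> 0" and sq: "\<And>x. \<exists>f.
       rad_sums P \<epsilon> (\<lambda>k. real k powr (1 / 2) *\<^sub>R ((T ^^ k) x - (T ^^ (k - 1)) x)) f \<and>
       L2_norm P f \<le> \<kappa> * norm x"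
    using assms(5) unfolding R_square_function_estimate_def by blast
  define c where "c = 4 * sqrt 24 * (2 powr ((1 + \<alpha>) / 2) * M) / (1 - 2 powr (- ((1 + \<alpha>) / 2)))"
  have "c \<ge> 0"
  proof -
    have "2 powr (- ((1 + \<alpha>) / 2)) < (1::real)"
      using assms(6) powr_less_mono[of "- ((1 + \<alpha>) / 2)" 0 2] by simp
    then show ?thesis unfolding c_def using R_bd_nonneg[OF M] by simp
  qed
  have "\<exists>f. rad_sums P \<epsilon> (\<lambda>k. real k powr (\<alpha> / 2) *\<^sub>R C ((T ^^ (k - 1)) x)) f \<and>
      L2_norm P f \<le> (3 * M + c * (2 * \<kappa>)) * norm x" for x
  proof -
    let ?z = "\<lambda>j. real j powr (1 / 2) *\<^sub>R ((T ^^ j) x - (T ^^ (j - 1)) x)"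
    let ?a = "\<lambda>k. real k powr (\<alpha> / 2) *\<^sub>R C ((T ^^ (k - 1)) x)"
    obtain f where f: "rad_sums P \<epsilon> ?z f" and f_le: "L2_norm P f \<le> \<kappa> * norm x"
      using sq by blast
    have tail: "rad_norm K ?a \<le> c * B"
      if "p \<ge> 1" "finite K" "K \<subseteq> {4 * p..}" and B: "\<And>q. rad_norm {p..q} ?z \<le> B" for p K B
      unfolding c_def
    proof (rule rad_norm_observed_tail[OF T C assms(6) M that(1-3)])
      fix J :: "nat set" assume J: "finite J" "J \<subseteq> {p..}"
      then have "J \<subseteq> {p..Max J}" by auto
      then have "rad_norm J ?z \<le> rad_norm {p..Max J} ?z"
        using \<open>p \<ge> 1\<close> by (intro rad_norm_mono) auto
      then show "rad_norm J ?z \<le> B" using B order_trans by blast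
    qed
    show ?thesis
    proof (rule rad_sums_complete[OF rs])
      fix e :: real assume "e > 0"
      \<comment> \<open>Division by \<open>c + 1\<close>, as \<open>c\<close> may be 0.\<close>
      then have "e / (c + 1) > 0" using \<open>c \<ge> 0\<close> by simp
      from rad_sums_bound(2)[OF rs f this] obtain p where
        p: "p \<ge> 1" "\<And>q. rad_norm {p..q} ?z < e / (c + 1)" by blast
      have "rad_norm {k..q} ?a < e" if "k \<ge> 4 * p" for k q
      proof -
        have "rad_norm {k..q} ?a \<le> c * (e / (c + 1))"
          using that p(1) by (intro tail[of p] less_imp_le[OF p(2)]) auto
        also have "\<dots> < e" using \<open>e > 0\<close> \<open>c \<ge> 0\<close> by (simp add: field_simps)
        finally show ?thesis .
      qed
      then show "\<exists>p0\<ge>1. \<forall>p\<ge>p0. \<forall>q. rad_norm {p..q} ?a < e"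
        using p(1) by (intro exI[of _ "4 * p"]) auto
    next
      fix n
      \<comment> \<open>With p = 1 the tail estimate starts at index 4. The indices 1, 2, 3 are
        bounded one by one by the decay estimate, since k^(\<alpha>/2) \<le>
        k^((1+\<alpha>)/2).\<close>
      let ?s = "\<lambda>k::nat. if k < 4 then 0 else 1 :: nat"
      have "rad_norm {1..n} ?a \<le> (\<Sum>s<2. rad_norm {k\<in>{1..n}. ?s k = s} ?a)"
        by (rule rad_norm_split) auto
      also have "\<dots> = rad_norm {k\<in>{1..n}. ?s k = 0} ?a + rad_norm {k\<in>{1..n}. ?s k = 1} ?a"
        by (simp add: numeral_2_eq_2)
      also have "rad_norm {k\<in>{1..n}. ?s k = 0} ?a \<le> (\<Sum>k\<in>{k\<in>{1..n}. ?s k = 0}. norm (?a k))"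
        by (rule rad_norm_le_sum) simp
      also have "\<dots> \<le> (\<Sum>k\<in>{1..3::nat}. norm (?a k))"
        by (rule sum_mono2) (auto split: if_splits)
      also have "\<dots> \<le> (\<Sum>k\<in>{1..3::nat}. M * norm x)"
      proof (rule sum_mono)
        fix k :: nat assume "k \<in> {1..3}"
        then have k: "k \<ge> 1" by simp
        have "(\<lambda>x. real k powr ((1 + \<alpha>) / 2) *\<^sub>R C ((T ^^ (k - 1)) x)) \<in>
            {\<lambda>x. real n powr ((1 + \<alpha>) / 2) *\<^sub>R C ((T ^^ (n - 1)) x) |n. n \<ge> 1}"
          using k by blast
        from R_bd_norm_le[OF M this, of x]
        have "real k powr ((1 + \<alpha>) / 2) * norm (C ((T ^^ (k - 1)) x)) \<le> M * norm x" by simp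
        moreover have "real k powr (\<alpha> / 2) \<le> real k powr ((1 + \<alpha>) / 2)"
          using k by (intro powr_mono) auto
        then have "norm (?a k) \<le> real k powr ((1 + \<alpha>) / 2) * norm (C ((T ^^ (k - 1)) x))"
          by (simp add: mult_right_mono)
        ultimately show "norm (?a k) \<le> M * norm x" by linarith
      qed
      also have "\<dots> = 3 * (M * norm x)" by simp
      also have "rad_norm {k\<in>{1..n}. ?s k = 1} ?a \<le> c * (2 * (\<kappa> * norm x))"
      proof (rule tail[of 1])
        fix q
        show "rad_norm {1..q} ?z \<le> 2 * (\<kappa> * norm x)"
          using rad_sums_bound(1)[OF rs f, of q] f_le by linarith
      qed (auto split: if_splits)
      finally show "rad_norm {1..n} ?a \<le> (3 * M + c * (2 * \<kappa>)) * norm x"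
        by (simp add: algebra_simps)
    qed
  qed
  moreover have "3 * M + c * (2 * \<kappa>) \<ge> 0"
    using R_bd_nonneg[OF M] \<open>c \<ge> 0\<close> \<kappa> by simp
  ultimately show ?thesis
    unfolding R_admissible_def using assms(10) by blast
qed

end
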